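(* Let $\phi: G_\infty\to\mathbb C$ be a continuous $K_\infty$-biinvariant function. Then $\phi$ is an Olshanski spherical function of $(G_\infty,K_\infty)$ if and only if there exists some $b\in H_q^{\mathbb C}$ such that $$\phi(g_a)=\psi_b(a):=\exp\left(-\langle a^2,b\rangle\right)\quad\text{for all } a\in\Pi_q .$$
   Context: Let $\mathbb F\in\{\mathbb R,\mathbb C,\mathbb H\}$ and fix an integer $q\ge 1$. $M_{p,q}$ is the space of $p\times q$-matrices over $\mathbb F$, $U_p$ the group of unitary $p\times p$-matrices over $\mathbb F$, $x^*$ the conjugate transpose. For integers $p\ge q$ let $G_p=M_{p,q}\rtimes U_p$, where $U_p$ acts on $M_{p,q}$ by left multiplication, i.e. $(x,u)(y,v)=(x+uy,uv)$, and let $K_p=U_p$ (identified with $\{0\}\times U_p$). $G_p$ is regarded as a closed subgroup of $G_{p+1}$ (append a zero row to $x$ and send $u$ to $\mathrm{diag}(u,1)$), so that $K_p=G_p\cap K_{p+1}$. Let $G_\infty=\lim_{\rightarrow}G_p$, $K_\infty=\lim_{\rightarrow}K_p$ be the inductive limits, with inductive limit topology. A continuous function $\phi:G_\infty\to\mathbb C$, not identically zero, is called an Olshanski spherical function of $(G_\infty,K_\infty)$ if it is $K_\infty$-biinvariant and $\phi(g)\phi(h)=\lim_{p\to\infty}\int_{K_p}\phi(gkh)\,dk$ for all $g,h\in G_\infty$, where $dk$ is the normalized Haar measure of $K_p$. $H_q=\{x\in M_{q,q}: x=x^*\}$ is the real vector space of Hermitian $q\times q$-matrices over $\mathbb F$,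 with scalar product $\langle x,y\rangle=\Re\,\mathrm{tr}(xy)$; $H_q^{\mathbb C}$ is its complexification, and $\langle\cdot,\cdot\rangle$ also denotes the extension to a Hermitian scalar product on $H_q^{\mathbb C}$ (linear in the first, conjugate-linear in the second argument). $\Pi_q\subset H_q$ is the set of positive semidefinite matrices. For $a\in\Pi_q$, $g_a\in G_\infty$ denotes the element $\left(\begin{pmatrix}a\\0\end{pmatrix},I\right)$, where $a$ is extended by zero rows and $I$ is the identity. The map $a\mapsto K_\infty g_aK_\infty$ is a homeomorphism from $\Pi_q$ onto the double coset space $G_\infty/\!/K_\infty$. *)

theory Defs
  imports
    "HOL-Analysis.Analysis"
    "HOL-Probability.Probability_Measure"
    "HOL-Library.Groups_Big_Fun"
begin

section \<open>The real division algebra of quaternions\<close>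

datatype quat = Quat (qre: real) (qi: real) (qj: real) (qk: real)

lemma quat_eq_iff: "x = y \<longleftrightarrow> qre x = qre y \<and> qi x = qi y \<and> qj x = qj y \<and> qk x = qk y"
  by (auto intro: quat.expand)

instantiation quat :: ab_group_add
begin

definition "0 = Quat 0 0 0 0"
definition "x + y = Quat (qre x + qre y) (qi x + qi y) (qj x + qj y) (qk x + qk y)"
definition "- x = Quat (- qre x) (- qi x) (- qj x) (- qk x)"
definition "x - y = Quat (qre x - qre y) (qi x - qi y) (qj x - qj y) (qk x - qk y)"

instance
  by standard
    (simp_all add: quat_eq_iff zero_quat_def plus_quat_def uminus_quat_def minus_quat_def)

end

lemma quat_zero_sel [simp]: "qre 0 = 0" "qi 0 = 0" "qj 0 = 0" "qk 0 = 0"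
  by (simp_all add: zero_quat_def)

lemma quat_plus_sel [simp]:
  "qre (x + y) = qre x + qre y" "qi (x + y) = qi x + qi y"
  "qj (x + y) = qj x + qj y" "qk (x + y) = qk x + qk y"
  by (simp_all add: plus_quat_def)

lemma quat_uminus_sel [simp]:
  "qre (- x) = - qre x" "qi (- x) = - qi x" "qj (- x) = - qj x" "qk (- x) = - qk x"
  by (simp_all add: uminus_quat_def)

lemma quat_minus_sel [simp]:
  "qre (x - y) = qre x - qre y" "qi (x - y) = qi x - qi y"
  "qj (x - y) = qj x - qj y" "qk (x - y) = qk x - qk y"
  by (simp_all add: minus_quat_def)

instantiation quat :: ring_1
begin

definition "1 = Quat 1 0 0 0"

definition "x * y = Quat
  (qre x * qre y - qi x * qi y - qj x * qj y - qk x * qk y)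
  (qre x * qi y + qi x * qre y + qj x * qk y - qk x * qj y)
  (qre x * qj y - qi x * qk y + qj x * qre y + qk x * qi y)
  (qre x * qk y + qi x * qj y - qj x * qi y + qk x * qre y)"

instance
  by standard
    (simp_all add: quat_eq_iff one_quat_def times_quat_def algebra_simps)

end

lemma quat_one_sel [simp]: "qre 1 = 1" "qi 1 = 0" "qj 1 = 0" "qk 1 = 0"
  by (simp_all add: one_quat_def)

lemma quat_times_sel [simp]:
  "qre (x * y) = qre x * qre y - qi x * qi y - qj x * qj y - qk x * qk y"
  "qi (x * y) = qre x * qi y + qi x * qre y + qj x * qk y - qk x * qj y"
  "qj (x * y) = qre x * qj y - qi x * qk y + qj x * qre y + qk x * qi y"
  "qk (x * y) = qre x * qk y + qi x * qj y - qj x * qi y + qk x * qre y"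
  by (simp_all add: times_quat_def)

instantiation quat :: real_algebra_1
begin

definition "scaleR r x = Quat (r * qre x) (r * qi x) (r * qj x) (r * qk x)"

instance
  by standard (simp_all add: quat_eq_iff scaleR_quat_def algebra_simps)

end

lemma quat_scaleR_sel [simp]:
  "qre (scaleR r x) = r * qre x" "qi (scaleR r x) = r * qi x"
  "qj (scaleR r x) = r * qj x" "qk (scaleR r x) = r * qk x"
  by (simp_all add: scaleR_quat_def)

lemma quat_of_real_sel [simp]:
  "qre (of_real r) = r" "qi (of_real r) = 0" "qj (of_real r) = 0" "qk (of_real r) = 0"
  by (simp_all add: of_real_def)

instantiation quat :: real_inner
begin

definition "inner x y = qre x * qre y + qi x * qi y + qj x * qj y + qk x * qk y"
definition "norm (x::quat) = sqrt (inner x x)"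
definition "sgn (x::quat) = x /\<^sub>R norm x"
definition "dist (x::quat) y = norm (x - y)"
definition [code del]:
  "(uniformity :: (quat \<times> quat) filter) = (INF e\<in>{0 <..}. principal {(x, y). dist x y < e})"
definition [code del]:
  "open (U :: quat set) \<longleftrightarrow> (\<forall>x\<in>U. eventually (\<lambda>(x', y). x' = x \<longrightarrow> y \<in> U) uniformity)"

instance
proof
  fix x y z :: quat and r :: real and U :: "quat set"
  show "dist x y = norm (x - y)" by (rule dist_quat_def)
  show "sgn x = x /\<^sub>R norm x" by (rule sgn_quat_def)
  show "uniformity = (INF e\<in>{0 <..}. principal {(x::quat, y). dist x y < e})"
    by (rule uniformity_quat_def)
  show "open U \<longleftrightarrow> (\<forall>x\<in>U. eventually (\<lambda>(x', y). x' = x \<longrightarrow> y \<in> U) uniformity)"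
    by (rule open_quat_def)
  show "inner x y = inner y x" by (simp add: inner_quat_def algebra_simps)
  show "inner (x + y) z = inner x z + inner y z" by (simp add: inner_quat_def algebra_simps)
  show "inner (r *\<^sub>R x) y = r * inner x y" by (simp add: inner_quat_def algebra_simps)
  show "0 \<le> inner x x" by (simp add: inner_quat_def)
  show "inner x x = 0 \<longleftrightarrow> x = 0"
    unfolding inner_quat_def quat_eq_iff[of x 0] quat_zero_sel
    by (simp only: add_nonneg_eq_0_iff add_nonneg_nonneg zero_le_square mult_eq_0_iff disj_absorb conj_assoc)
  show "norm x = sqrt (inner x x)" by (rule norm_quat_def)
qed

end

instantiation quat :: real_normed_div_algebra
begin

definition "inverse x = Quat (qre x / inner x x) (- qi x / inner x x) (- qj x / inner x x) (- qk x / inner x x)"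
definition "x div (y::quat) = x * inverse y"

instance
proof
  fix x y :: quat
  show "x div y = x * inverse y" by (rule divide_quat_def)
  show "inverse (0::quat) = 0" by (simp add: inverse_quat_def quat_eq_iff)
  show "norm (x * y) = norm x * norm y"
    unfolding norm_quat_def real_sqrt_mult[symmetric]
    unfolding inner_quat_def quat_times_sel by (rule arg_cong[where f=sqrt]) algebra
  assume "x \<noteq> 0"
  then have nz: "inner x x \<noteq> 0" by simp
  let ?s = "Quat (qre x) (- qi x) (- qj x) (- qk x)"
  have inv: "inverse x = (1 / inner x x) *\<^sub>R ?s"
    by (simp add: inverse_quat_def quat_eq_iff)
  have s: "?s * x = inner x x *\<^sub>R 1" "x * ?s = inner x x *\<^sub>R 1"
    unfolding quat_eq_iff[of "_ * _"] by (simp_all add: inner_quat_def)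
  show "inverse x * x = 1" "x * inverse x = 1"
    unfolding inv mult_scaleR_left mult_scaleR_right s scaleR_scaleR
    by (simp_all only: times_divide_eq_left mult_1_left divide_self[OF nz] scaleR_one)
qed

end

instantiation quat :: euclidean_space
begin

definition "Basis = {Quat 1 0 0 0, Quat 0 1 0 0, Quat 0 0 1 0, Quat 0 0 0 1}"

instance
proof
  fix u v x :: quat
  show "(Basis :: quat set) \<noteq> {}" "finite (Basis :: quat set)"
    by (simp_all add: Basis_quat_def)
  show "inner u v = (if u = v then 1 else 0)" if "u \<in> Basis" "v \<in> Basis"
    using that unfolding Basis_quat_def
    by (elim insertE emptyE) (simp_all add: inner_quat_def)
  show "(\<forall>u\<in>Basis. inner x u = 0) \<longleftrightarrow> x = 0"
    unfolding Basis_quat_def quat_eq_iff[of x 0] by (simp add: inner_quat_def)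
qed

end


section \<open>The three base algebras\<close>

class star_div_algebra = real_normed_div_algebra + euclidean_space +
  fixes star :: "'a \<Rightarrow> 'a" and repart :: "'a \<Rightarrow> real"
  assumes star_star: "star (star x) = x"
    and star_add: "star (x + y) = star x + star y"
    and star_scaleR: "star (scaleR r x) = scaleR r (star x)"
    and star_mult: "star (x * y) = star y * star x"
    and star_mult_self: "star x * x = scaleR ((norm x)\<^sup>2) 1"
    and add_star_self: "x + star x = scaleR (2 * repart x) 1"

instantiation real :: star_div_algebra
begin

definition "star (x::real) = x"
definition "repart (x::real) = x"

instance
  by standard (simp_all add: star_real_def repart_real_def power2_eq_square)

end

instantiation complex :: star_div_algebra
begin

definition "star x = cnj x"
definition "repart x = Re x"

instance
proof
  fix x y :: complex and r :: real
  show "star x * x = (cmod x)\<^sup>2 *\<^sub>R 1"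
    unfolding star_complex_def mult.commute[of "cnj x"] complex_norm_square[symmetric]
    by (simp add: scaleR_conv_of_real)
  show "x + star x = (2 * repart x) *\<^sub>R 1"
    by (simp add: star_complex_def repart_complex_def complex_add_cnj scaleR_conv_of_real)
qed (simp_all add: star_complex_def)

end

instantiation quat :: star_div_algebra
begin

definition "star x = Quat (qre x) (- qi x) (- qj x) (- qk x)"
definition "repart x = qre x"

instance
proof
  fix x y :: quat and r :: real
  show "star x * x = (norm x)\<^sup>2 *\<^sub>R 1"
    unfolding power2_norm_eq_inner inner_quat_def star_quat_def quat_eq_iff[of "_ * _"] by simp
  show "x + star x = (2 * repart x) *\<^sub>R 1"
    unfolding star_quat_def repart_quat_def quat_eq_iff[of "_ + _"] by simp
  show "star (x * y) = star y * star x"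
    unfolding star_quat_def quat_eq_iff[of _ "_ * _"] by simp
qed (simp_all add: star_quat_def quat_eq_iff)

end


section \<open>Matrices\<close>

text \<open>
  All matrices are \<open>\<nat> \<times> \<nat>\<close>-arrays. A \<open>p \<times> q\<close>-matrix is stored in the upper left corner and
  padded by zeros, a unitary \<open>p \<times> p\<close>-matrix \<open>u\<close> is stored as \<open>diag(u, 1, 1, \<dots>)\<close>. In this way
  the embeddings \<open>x \<mapsto> (x; 0)\<close>, \<open>u \<mapsto> diag(u, 1)\<close> are inclusions, and the inductive limits are
  unions.
\<close>

type_synonym 'f arr = "nat \<Rightarrow> nat \<Rightarrow> 'f"

definition arr_zero :: "'f::star_div_algebra arr" where
  "arr_zero = (\<lambda>i j. 0)"

definition arr_one :: "'f::star_div_algebra arr" where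
  "arr_one = (\<lambda>i j. if i = j then 1 else 0)"

definition arr_add :: "'f::star_div_algebra arr \<Rightarrow> 'f arr \<Rightarrow> 'f arr" where
  "arr_add x y = (\<lambda>i j. x i j + y i j)"

text \<open>
  \<^const>\<open>Sum_any\<close> sums over the support; the supports below are finite, as all arrays in use
  have only finitely many nonzero entries in each row.
\<close>

definition arr_mult :: "'f::star_div_algebra arr \<Rightarrow> 'f arr \<Rightarrow> 'f arr" where
  "arr_mult x y = (\<lambda>i j. Sum_any (\<lambda>k. x i k * y k j))"

definition arr_adj :: "'f::star_div_algebra arr \<Rightarrow> 'f arr" where
  "arr_adj x = (\<lambda>i j. star (x j i))"

definition Mat :: "nat \<Rightarrow> nat \<Rightarrow> 'f::star_div_algebra arr set" where
  "Mat p q = {x. \<forall>i j. i \<ge> p \<or> j \<ge> q \<longrightarrow> x i j = 0}"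

definition Uni :: "nat \<Rightarrow> 'f::star_div_algebra arr set" where
  "Uni p = {u. (\<forall>i j. i \<ge> p \<or> j \<ge> p \<longrightarrow> u i j = arr_one i j) \<and>
               arr_mult u (arr_adj u) = arr_one \<and> arr_mult (arr_adj u) u = arr_one}"

definition Herm :: "nat \<Rightarrow> 'f::star_div_algebra arr set" where
  "Herm q = {x \<in> Mat q q. arr_adj x = x}"

definition Psd :: "nat \<Rightarrow> 'f::star_div_algebra arr set" where
  "Psd q = {x \<in> Herm q.
     \<forall>v :: nat \<Rightarrow> 'f. 0 \<le> repart (\<Sum>i<q. \<Sum>j<q. star (v i) * x i j * v j)}"

definition herm_inner :: "nat \<Rightarrow> 'f::star_div_algebra arr \<Rightarrow> 'f arr \<Rightarrow> real" where
  "herm_inner q x y = repart (\<Sum>i<q. arr_mult x y i i)"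

text \<open>
  The complexification of \<^term>\<open>Herm q\<close> consists of the pairs \<open>(x\<^sub>1, x\<^sub>2)\<close>, read as
  \<open>x\<^sub>1 + \<i> x\<^sub>2\<close> with a new imaginary unit \<open>\<i>\<close> (also if the entries are complex or
  quaternionic). The scalar product is extended to be linear in the first and conjugate-linear
  in the second argument.
\<close>

definition HermC :: "nat \<Rightarrow> ('f::star_div_algebra arr \<times> 'f arr) set" where
  "HermC q = Herm q \<times> Herm q"

definition hermC_inner ::
    "nat \<Rightarrow> 'f::star_div_algebra arr \<times> 'f arr \<Rightarrow> 'f arr \<times> 'f arr \<Rightarrow> complex" where
  "hermC_inner q x y =
     (complex_of_real (herm_inner q (fst x) (fst y)) + \<i> * complex_of_real (herm_inner q (snd x) (fst y)))
     - \<i> * (complex_of_real (herm_inner q (fst x) (snd y)) + \<i> * complex_of_real (herm_inner q (snd x) (snd y)))"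

definition psi :: "nat \<Rightarrow> 'f::star_div_algebra arr \<times> 'f arr \<Rightarrow> 'f arr \<Rightarrow> complex" where
  "psi q b a = exp (- hermC_inner q (arr_mult a a, arr_zero) b)"


section \<open>The groups and their inductive limits\<close>

type_synonym 'f elt = "'f arr \<times> 'f arr"

definition gmult :: "'f::star_div_algebra elt \<Rightarrow> 'f elt \<Rightarrow> 'f elt" where
  "gmult g h = (arr_add (fst g) (arr_mult (snd g) (fst h)), arr_mult (snd g) (snd h))"

definition G :: "nat \<Rightarrow> nat \<Rightarrow> 'f::star_div_algebra elt set" where
  "G q p = Mat p q \<times> Uni p"

definition K :: "nat \<Rightarrow> 'f::star_div_algebra elt set" where
  "K p = {arr_zero} \<times> Uni p"

definition Ginf :: "nat \<Rightarrow> 'f::star_div_algebra elt set" where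
  "Ginf q = (\<Union>p\<in>{q..}. G q p)"

definition Kinf :: "nat \<Rightarrow> 'f::star_div_algebra elt set" where
  "Kinf q = (\<Union>p\<in>{q..}. K p)"

text \<open>
  The topology of \<^term>\<open>G q p\<close> is the subspace topology of entrywise convergence. As all but
  finitely many entries are constant on \<^term>\<open>G q p\<close>, it is the usual topology of matrices.
  The inductive limit topology is the final topology for the inclusions of the \<^term>\<open>G q p\<close>.
\<close>

definition Ginf_topology :: "nat \<Rightarrow> 'f::star_div_algebra elt topology" where
  "Ginf_topology q = topology (\<lambda>W. W \<subseteq> Ginf q \<and>
     (\<forall>p\<ge>q. openin (top_of_set (G q p)) (W \<inter> G q p)))"

lemma openin_Ginf_topology:
  "openin (Ginf_topology q) W \<longleftrightarrow>
     W \<subseteq> Ginf q \<and> (\<forall>p\<ge>q. openin (top_of_set (G q p)) (W \<inter> G q p))"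
proof -
  let ?P = "\<lambda>W :: 'a elt set. W \<subseteq> Ginf q \<and>
     (\<forall>p\<ge>q. openin (top_of_set (G q p)) (W \<inter> G q p))"
  have "?P (S \<inter> T)" if "?P S" "?P T" for S T
  proof (intro conjI allI impI)
    show "S \<inter> T \<subseteq> Ginf q" using that by blast
    fix p assume "q \<le> p"
    then have "openin (top_of_set (G q p)) ((S \<inter> G q p) \<inter> (T \<inter> G q p))"
      using that by (blast intro: openin_Int[of _ "S \<inter> G q p" "T \<inter> G q p"])
    moreover have "(S \<inter> G q p) \<inter> (T \<inter> G q p) = (S \<inter> T) \<inter> G q p" by blast
    ultimately show "openin (top_of_set (G q p)) ((S \<inter> T) \<inter> G q p)" by simp
  qed
  moreover have "?P (\<Union>\<K>)" if "\<forall>S\<in>\<K>. ?P S" for \<K>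
  proof (intro conjI allI impI)
    show "\<Union>\<K> \<subseteq> Ginf q" using that by blast
    fix p assume "q \<le> p"
    then have "openin (top_of_set (G q p)) (\<Union>S\<in>\<K>. S \<inter> G q p)"
      using that by (intro openin_Union) auto
    moreover have "(\<Union>S\<in>\<K>. S \<inter> G q p) = \<Union>\<K> \<inter> G q p" by blast
    ultimately show "openin (top_of_set (G q p)) (\<Union>\<K> \<inter> G q p)" by simp
  qed
  ultimately have "istopology ?P"
    unfolding istopology_def by blast
  then show ?thesis
    unfolding Ginf_topology_def by (simp add: topology_inverse')
qed

definition g_elt :: "'f::star_div_algebra arr \<Rightarrow> 'f elt" where
  "g_elt a = (a, arr_one)"

definition K_biinvariant :: "nat \<Rightarrow> ('f::star_div_algebra elt \<Rightarrow> complex) \<Rightarrow> bool" where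
  "K_biinvariant q \<phi> \<longleftrightarrow>
     (\<forall>g\<in>Ginf q. \<forall>k\<in>Kinf q. \<forall>k'\<in>Kinf q. \<phi> (gmult (gmult k g) k') = \<phi> g)"

text \<open>
  Normalized Haar measure of the compact group \<^term>\<open>K p\<close>, characterized as the
  (unique) left invariant Borel probability measure.
\<close>

definition normalized_haar :: "nat \<Rightarrow> 'f::star_div_algebra elt measure \<Rightarrow> bool" where
  "normalized_haar p \<mu> \<longleftrightarrow>
     prob_space \<mu> \<and> sets \<mu> = sets (restrict_space borel (K p)) \<and>
     (\<forall>k\<in>K p. \<forall>A\<in>sets \<mu>. emeasure \<mu> (gmult k ` A) = emeasure \<mu> A)"

text \<open>The family \<open>\<mu>\<close> provides the normalized Haar measures of the groups \<^term>\<open>K p\<close>.\<close>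

definition olshanski_spherical ::
    "nat \<Rightarrow> (nat \<Rightarrow> 'f::star_div_algebra elt measure) \<Rightarrow> ('f elt \<Rightarrow> complex) \<Rightarrow> bool" where
  "olshanski_spherical q \<mu> \<phi> \<longleftrightarrow>
     continuous_map (Ginf_topology q) euclidean \<phi> \<and>
     (\<exists>g\<in>Ginf q. \<phi> g \<noteq> 0) \<and>
     K_biinvariant q \<phi> \<and>
     (\<forall>g\<in>Ginf q. \<forall>h\<in>Ginf q.
        (\<lambda>p. LINT k|\<mu> p. \<phi> (gmult (gmult g k) h)) \<longlonglongrightarrow> \<phi> g * \<phi> h)"

end

theory Submission
  imports Defs
begin

text \<open>
  Write \<open>gram x = x\<^sup>* x\<close> and \<open>\<Phi> x = \<phi> (x, 1)\<close>. The proof rests on three facts.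

  \<^item> A biinvariant \<open>\<phi>\<close> is a function of the Gram matrix alone: \<open>\<phi> (x, u) = \<Phi> x\<close>, and \<open>\<Phi> x\<close> depends
    only on \<open>gram x\<close>. Two matrices with the same Gram matrix lie in one \<open>U\<^sub>p\<close>-orbit
    (\<open>gram_eq_imp_Uni_orbit\<close>, a Witt extension theorem), and every orbit meets the positive
    semidefinite matrices (\<open>polar_decomposition\<close>). On \<open>a \<in> \<Pi>\<^sub>q\<close> the Gram matrix is \<open>a\<^sup>2\<close>, which is why
    \<open>a\<^sup>2\<close> appears in \<open>\<psi>\<^sub>b\<close>.

  \<^item> For fixed \<open>g = (x, u)\<close> and \<open>h = (y, v)\<close>, \<open>g k h\<close> has the first component \<open>x + u k y\<close>, with Gram matrix
    \<open>gram x + gram y\<close> plus the cross term \<open>x\<^sup>* u k y\<close> and its adjoint. The cross term involves a fixed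
    number of entries of \<open>k\<close>, and these tend to \<open>0\<close> in mean square as \<open>p \<rightarrow> \<infinity>\<close>, because
    \<open>E |k\<^sub>i\<^sub>j|\<^sup>2 = 1/p\<close> (\<open>normalized_haar_second_moment\<close>). Hence the integrals converge to \<open>\<Phi> z\<close> for any \<open>z\<close>
    with \<open>gram z = gram x + gram y\<close> (\<open>integral_phi_gmult_tendsto\<close>).

  \<^item> So \<open>\<phi>\<close> is spherical iff, as a function on the cone of Gram matrices, it is multiplicative,
    \<open>F (r + s) = F r * F s\<close>, and nonzero. A continuous multiplicative function is
    exponential on each ray; its exponent is additive and positively homogeneous on the cone, hence
    extends linearly to \<open>H\<^sub>q\<close> and is a scalar product against some \<open>b\<close>.

  Everything is done uniformly for a division algebra with an involution; noncommutativity only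
  permits to move factors cyclically under the real part. The unitary matrices that occur are all
  built from the rank one perturbations \<open>1 - d c d\<^sup>*\<close> of the identity (\<open>householder\<close>): they carry one column
  to another in the extension theorem, they are the competitors in the extremal problem behind
  the polar decomposition, and they exchange two rows in the computation of the second moment.
\<close>

section \<open>Involution and real part\<close>

lemma star_zero [simp]: "star (0::'f::star_div_algebra) = 0"
  using star_scaleR[of 0 "0::'f"] by simp

lemma star_one [simp]: "star (1::'f::star_div_algebra) = 1"
  using star_mult[of "star (1::'f)" 1] star_star[of "1::'f"] by simp

lemma star_minus: "star (- x) = - star (x::'f::star_div_algebra)"
  using star_scaleR[of "-1" x] by simp

lemma star_diff: "star (x - y) = star x - star (y::'f::star_div_algebra)"
  using star_add[of x "-y"] by (simp add: star_minus)

lemma star_sum: "star (sum f A) = (\<Sum>i\<in>A. star (f i :: 'f::star_div_algebra))"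
  by (induction A rule: infinite_finite_induct) (auto simp: star_add)

lemma star_eq_0_iff [simp]: "star x = 0 \<longleftrightarrow> (x::'f::star_div_algebra) = 0"
  by (metis star_star star_zero)

lemma norm_star [simp]: "norm (star x) = norm (x::'f::star_div_algebra)"
proof (cases "x = 0")
  case False
  have "norm (star x) * norm x = norm x * norm x"
    using arg_cong[OF star_mult_self[of x], of norm] by (simp add: norm_mult power2_eq_square)
  then show ?thesis using False by simp
qed simp

text \<open>
  Polarization of \<open>star_mult_self\<close>. All linearity and continuity properties of \<open>repart\<close> are drawn
  from this link with the inner product.
\<close>
lemma inner_eq_repart: "inner x y = repart (star x * (y::'f::star_div_algebra))"
proof -
  have "((norm (x + y))\<^sup>2) *\<^sub>R (1::'f) = star (x + y) * (x + y)"
    by (simp add: star_mult_self)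
  also have "\<dots> = star x * x + star y * y + (star x * y + star (star x * y))"
    by (simp add: star_add star_mult star_star algebra_simps)
  also have "\<dots> = ((norm x)\<^sup>2 + (norm y)\<^sup>2 + 2 * repart (star x * y)) *\<^sub>R (1::'f)"
    by (simp only: add_star_self star_mult_self scaleR_add_left)
  finally have "(norm (x + y))\<^sup>2 = (norm x)\<^sup>2 + (norm y)\<^sup>2 + 2 * repart (star x * y)"
    by (simp only: scaleR_cancel_right) simp
  then show ?thesis
    by (simp add: power2_norm_eq_inner inner_add_left inner_add_right inner_commute)
qed

lemma repart_eq_inner: "repart x = inner 1 (x::'f::star_div_algebra)"
  by (simp add: inner_eq_repart)

lemma repart_simps [simp]:
  "repart (0::'f::star_div_algebra) = 0" "repart (1::'f) = 1"
  "repart (x + y :: 'f) = repart x + repart y" "repart (x - y :: 'f) = repart x - repart y"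
  "repart (- x :: 'f) = - repart x" "repart (r *\<^sub>R x :: 'f) = r * repart x"
  by (simp_all add: repart_eq_inner inner_add_right inner_diff_right dot_square_norm)

lemma repart_sum: "repart (sum f A) = (\<Sum>i\<in>A. repart (f i :: 'f::star_div_algebra))"
  by (simp add: repart_eq_inner inner_sum_right)

lemma inner_star_star [simp]: "inner (star x) (star y) = inner x (y::'f::star_div_algebra)"
proof -
  have "(norm (star (x + y)))\<^sup>2 = (norm (x + y))\<^sup>2" by simp
  then have "inner (star x + star y) (star x + star y) = inner (x + y) (x + y)"
    by (simp add: power2_norm_eq_inner star_add)
  moreover have "inner (star x) (star x) = inner x x" "inner (star y) (star y) = inner y y"
    by (simp_all add: dot_square_norm)
  ultimately show ?thesis
    by (simp add: inner_add_left inner_add_right inner_commute)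
qed

lemma repart_star [simp]: "repart (star x) = repart (x::'f::star_div_algebra)"
  using inner_star_star[of 1 x] by (simp add: repart_eq_inner)

text \<open>
  The substitute for commutativity: the involution is an isometry, so both sides are inner products
  of the same two elements.
\<close>
lemma repart_mult_commute: "repart (x * y) = repart (y * (x::'f::star_div_algebra))"
proof -
  have "repart (x * y) = inner (star x) (star (star y))"
    by (simp add: inner_eq_repart star_star)
  also have "\<dots> = repart (y * x)"
    unfolding inner_star_star inner_commute[of x] by (simp add: inner_eq_repart star_star)
  finally show ?thesis .
qed

lemma repart_mult_star_self: "repart (star x * x) = (norm (x::'f::star_div_algebra))\<^sup>2"
  by (simp add: star_mult_self)

lemma mult_star_self: "x * star x = ((norm (x::'f::star_div_algebra))\<^sup>2) *\<^sub>R 1"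
  using star_mult_self[of "star x"] by (simp add: star_star)

text \<open>
  The real part is the inner product with \<open>1\<close>; equality in the Cauchy-Schwarz inequality forces
  the element to be a real multiple of \<open>1\<close>.
\<close>
lemma star_eq_if_norm_le_repart:
  assumes "norm x \<le> repart (x::'f::star_div_algebra)"
  shows "star x = x"
proof -
  have "(norm x)\<^sup>2 \<le> (repart x)\<^sup>2" using assms by (simp add: power_mono)
  moreover have "(norm (x - repart x *\<^sub>R 1))\<^sup>2 = (norm x)\<^sup>2 - (repart x)\<^sup>2"
  proof -
    have "inner 1 (1::'f) = 1" by (simp add: dot_square_norm)
    then show ?thesis
      unfolding power2_norm_eq_inner repart_eq_inner
      by (simp only: inner_diff_left inner_diff_right inner_scaleR_left inner_scaleR_right
            inner_commute[of x 1] power2_eq_square) simp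
  qed
  ultimately have "norm (x - repart x *\<^sub>R 1) = 0"
    by (smt (verit) zero_le_power2 power2_eq_iff_nonneg norm_ge_zero zero_eq_power2)
  then have "x = repart x *\<^sub>R 1" by simp
  then show ?thesis by (metis star_scaleR star_one)
qed

text \<open>
  The existence of a phase, valid without commutativity.
\<close>
lemma exists_unit_rotating_to_norm:
  fixes x :: "'f::star_div_algebra"
  obtains l where "norm l = 1" "x * l = norm x *\<^sub>R 1" "l * x = norm x *\<^sub>R 1"
proof (cases "x = 0")
  case True then show ?thesis using that[of 1] by simp
next
  case False
  show ?thesis
    by (rule that[of "inverse (norm x) *\<^sub>R star x"])
      (use False in \<open>simp_all add: mult_star_self star_mult_self power2_eq_square\<close>)
qed

lemma linear_star: "linear (star :: 'f::star_div_algebra \<Rightarrow> 'f)"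
  by (intro linearI) (simp_all add: star_add star_scaleR)

lemma continuous_on_star [continuous_intros]:
  "continuous_on A f \<Longrightarrow> continuous_on A (\<lambda>x. star (f x :: 'f::star_div_algebra))"
  using linear_continuous_on[OF linear_star[unfolded linear_conv_bounded_linear], of UNIV]
  by (rule continuous_on_compose2) auto

lemma continuous_on_repart [continuous_intros]:
  "continuous_on A f \<Longrightarrow> continuous_on A (\<lambda>x. repart (f x :: 'f::star_div_algebra))"
  unfolding repart_eq_inner by (intro continuous_intros)

section \<open>Products of arrays\<close>

text \<open>
  Rows of such an array with index \<open>i < P\<close>, where \<open>N \<le> P\<close>, are supported in the first \<open>P\<close> columns. Both padded
  matrices and padded unitary matrices have this property, and it makes products computable by finite sums
  and associative.
\<close>
definition lower_beyond :: "nat \<Rightarrow> 'f::star_div_algebra arr \<Rightarrow> bool" where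
  "lower_beyond N x \<longleftrightarrow> (\<forall>i k. N \<le> k \<and> i < k \<longrightarrow> x i k = 0)"

lemma arr_mult_eq_sum:
  assumes "lower_beyond N x" "N \<le> P" "i < P"
  shows "arr_mult x y i j = (\<Sum>k<P. x i k * y k j)"
proof -
  have "x i k = 0" if "P \<le> k" for k
    using assms that by (auto simp: lower_beyond_def)
  then have "{k. x i k * y k j \<noteq> 0} \<subseteq> {..<P}"
    by (auto simp: not_less[symmetric])
  then show ?thesis
    unfolding arr_mult_def by (intro Sum_any.expand_superset) auto
qed

lemma lower_beyond_mult:
  assumes "lower_beyond N x" "lower_beyond N y"
  shows "lower_beyond N (arr_mult x y)"
  unfolding lower_beyond_def
proof (intro allI impI)
  fix i k assume *: "N \<le> k \<and> i < k"
  then have "arr_mult x y i k = (\<Sum>l<k. x i l * y l k)"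
    using assms(1) by (intro arr_mult_eq_sum) auto
  also have "\<dots> = 0"
    using assms(2) * by (intro sum.neutral) (auto simp: lower_beyond_def)
  finally show "arr_mult x y i k = 0" .
qed

lemma arr_mult_assoc:
  assumes "lower_beyond N x" "lower_beyond N y"
  shows "arr_mult (arr_mult x y) z = arr_mult x (arr_mult y z)"
proof (intro ext)
  fix i j
  define P where "P = max N (Suc i)"
  have P: "N \<le> P" "i < P" by (auto simp: P_def)
  have "arr_mult (arr_mult x y) z i j = (\<Sum>k<P. (\<Sum>l<P. x i l * y l k) * z k j)"
    using arr_mult_eq_sum[OF lower_beyond_mult[OF assms] P] arr_mult_eq_sum[OF assms(1) P]
    by simp
  also have "\<dots> = (\<Sum>l<P. \<Sum>k<P. x i l * (y l k * z k j))"
    unfolding sum_distrib_right mult.assoc by (rule sum.swap)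
  also have "\<dots> = (\<Sum>l<P. x i l * arr_mult y z l j)"
    by (intro sum.cong refl)
       (simp add: arr_mult_eq_sum[OF assms(2) P(1)] sum_distrib_left)
  also have "\<dots> = arr_mult x (arr_mult y z) i j"
    by (rule arr_mult_eq_sum[OF assms(1) P, symmetric])
  finally show "arr_mult (arr_mult x y) z i j = arr_mult x (arr_mult y z) i j" .
qed

lemma arr_adj_adj [simp]: "arr_adj (arr_adj x) = x"
  by (simp add: arr_adj_def star_star)

lemma arr_adj_mult:
  assumes "lower_beyond N x" "lower_beyond N (arr_adj y)"
  shows "arr_adj (arr_mult x y) = arr_mult (arr_adj y) (arr_adj x)"
proof (intro ext)
  fix i j
  define P where "P = max N (Suc (max i j))"
  have P: "N \<le> P" "i < P" "j < P" by (auto simp: P_def)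
  show "arr_adj (arr_mult x y) i j = arr_mult (arr_adj y) (arr_adj x) i j"
    unfolding arr_mult_eq_sum[OF assms(2) P(1,2)]
    by (simp add: arr_adj_def[of "arr_mult x y"] arr_mult_eq_sum[OF assms(1) P(1,3)])
       (simp add: arr_adj_def star_sum star_mult)
qed

lemma arr_mult_one [simp]: "arr_mult arr_one x = x" "arr_mult x arr_one = x"
proof -
  have "arr_mult arr_one x i j = x i j" for i j
    unfolding arr_mult_def arr_one_def
    by (subst Sum_any.expand_superset[of "{i}"]) (auto split: if_splits)
  then show "arr_mult arr_one x = x" by blast
  have "arr_mult x arr_one i j = x i j" for i j
    unfolding arr_mult_def arr_one_def
    by (subst Sum_any.expand_superset[of "{j}"]) (auto split: if_splits)
  then show "arr_mult x arr_one = x" by blast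
qed

lemma arr_mult_zero [simp]: "arr_mult x arr_zero = arr_zero" "arr_mult arr_zero x = arr_zero"
  by (simp_all add: arr_mult_def arr_zero_def)

lemma arr_add_zero [simp]: "arr_add x arr_zero = x" "arr_add arr_zero x = x"
  by (simp_all add: arr_add_def arr_zero_def)

lemma arr_adj_one [simp]: "arr_adj arr_one = arr_one"
  by (intro ext) (simp add: arr_adj_def arr_one_def)

lemma Mat_mono: "x \<in> Mat p q \<Longrightarrow> p \<le> p' \<Longrightarrow> x \<in> Mat p' q"
  by (auto simp: Mat_def)

lemma Mat_adj: "x \<in> Mat p q \<Longrightarrow> arr_adj x \<in> Mat q p"
  by (auto simp: Mat_def arr_adj_def)

lemma zero_in_Mat: "arr_zero \<in> Mat p q"
  by (auto simp: Mat_def arr_zero_def)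

lemma lower_beyond_Mat: "x \<in> Mat p q \<Longrightarrow> q \<le> N \<Longrightarrow> lower_beyond N x"
  by (auto simp: Mat_def lower_beyond_def)

lemma lower_beyond_Uni: "u \<in> Uni p \<Longrightarrow> p \<le> N \<Longrightarrow> lower_beyond N u"
  by (auto simp: Uni_def lower_beyond_def arr_one_def)

lemma Uni_adj: "u \<in> Uni p \<Longrightarrow> arr_adj u \<in> Uni p"
proof -
  assume u: "u \<in> Uni p"
  have "arr_adj u i j = arr_one i j" if "p \<le> i \<or> p \<le> j" for i j
    using u that by (auto simp: Uni_def arr_adj_def arr_one_def)
  then show ?thesis using u by (simp add: Uni_def)
qed

lemma Uni_mono:
  assumes "u \<in> Uni p" "p \<le> p'"
  shows "u \<in> Uni p'"
  using assms unfolding Uni_def by force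

lemma Uni_inverse:
  assumes "u \<in> Uni p"
  shows "arr_mult u (arr_adj u) = arr_one" "arr_mult (arr_adj u) u = arr_one"
  using assms by (simp_all add: Uni_def)

lemma Uni_pad: "u \<in> Uni p \<Longrightarrow> p \<le> i \<or> p \<le> j \<Longrightarrow> u i j = arr_one i j"
  unfolding Uni_def by blast

lemma one_in_Uni: "arr_one \<in> Uni p"
  by (simp add: Uni_def)

lemma Uni_mult_assoc:
  "u \<in> Uni p \<Longrightarrow> v \<in> Uni p \<Longrightarrow> arr_mult (arr_mult u v) x = arr_mult u (arr_mult v x)"
  by (blast intro: arr_mult_assoc lower_beyond_Uni)

text \<open>
  The padding by the identity leaves the lower rows untouched.
\<close>
lemma Uni_mult_row:
  assumes "u \<in> Uni p" "p \<le> i"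
  shows "arr_mult u x i j = x i j"
proof -
  have "arr_mult u x i j = (\<Sum>k<Suc i. u i k * x k j)"
    using assms by (intro arr_mult_eq_sum[OF lower_beyond_Uni[OF assms(1) order_refl]]) auto
  also have "\<dots> = (\<Sum>k<Suc i. if k = i then x k j else 0)"
    using assms by (intro sum.cong) (auto simp: Uni_pad arr_one_def)
  finally show ?thesis by simp
qed

lemma Uni_mult_eq_sum:
  assumes "u \<in> Uni p" "i < p"
  shows "arr_mult u x i j = (\<Sum>k<p. u i k * x k j)"
  using assms arr_mult_eq_sum lower_beyond_Uni by blast

lemma Uni_mult:
  assumes u: "u \<in> Uni p" and v: "v \<in> Uni p"
  shows "arr_mult u v \<in> Uni p"
proof -
  have pad: "arr_mult u v i j = arr_one i j" if "p \<le> i \<or> p \<le> j" for i j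
  proof (cases "p \<le> i")
    case True then show ?thesis using Uni_mult_row[OF u] v that by (simp add: Uni_pad)
  next
    case False
    then have "arr_mult u v i j = (\<Sum>k<p. u i k * v k j)" using u by (intro Uni_mult_eq_sum) auto
    also have "\<dots> = 0" using False that v
      by (intro sum.neutral) (auto simp: Uni_pad arr_one_def)
    finally show ?thesis using False that by (auto simp: arr_one_def)
  qed
  have adj: "arr_adj (arr_mult u v) = arr_mult (arr_adj v) (arr_adj u)"
    using u v by (intro arr_adj_mult[where N=p]) (auto intro: lower_beyond_Uni Uni_adj)
  have 1: "arr_mult v (arr_mult (arr_adj v) (arr_adj u)) = arr_adj u"
    by (simp add: Uni_mult_assoc[OF v Uni_adj[OF v], symmetric] Uni_inverse[OF v])
  have 2: "arr_mult (arr_adj u) (arr_mult u v) = v"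
    by (simp add: Uni_mult_assoc[OF Uni_adj[OF u] u, symmetric] Uni_inverse[OF u])
  have "arr_mult (arr_mult u v) (arr_adj (arr_mult u v)) = arr_one"
    unfolding adj Uni_mult_assoc[OF u v] 1 by (rule Uni_inverse(1)[OF u])
  moreover have "arr_mult (arr_adj (arr_mult u v)) (arr_mult u v) = arr_one"
    unfolding adj Uni_mult_assoc[OF Uni_adj[OF v] Uni_adj[OF u]] 2 by (rule Uni_inverse(2)[OF v])
  ultimately show ?thesis using pad by (simp add: Uni_def)
qed

lemma Uni_mult_Mat:
  assumes "u \<in> Uni p" "x \<in> Mat p q"
  shows "arr_mult u x \<in> Mat p q"
proof -
  have "arr_mult u x i j = 0" if "p \<le> i \<or> q \<le> j" for i j
  proof (cases "p \<le> i")
    case True then show ?thesis using assms by (simp add: Uni_mult_row Mat_def)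
  next
    case False
    then show ?thesis using assms that by (simp add: Uni_mult_eq_sum Mat_def)
  qed
  then show ?thesis by (simp add: Mat_def)
qed

lemma Uni_mult_add:
  assumes "u \<in> Uni p"
  shows "arr_mult u (arr_add x y) = arr_add (arr_mult u x) (arr_mult u y)"
proof (intro ext)
  fix i j
  show "arr_mult u (arr_add x y) i j = arr_add (arr_mult u x) (arr_mult u y) i j"
    using assms
    by (cases "p \<le> i") (simp_all add: arr_add_def Uni_mult_row Uni_mult_eq_sum
        algebra_simps sum.distrib)
qed

section \<open>Rank one perturbations of the identity\<close>

lemma star_mult_self_left: "star a * (a * b) = (norm a)\<^sup>2 *\<^sub>R (b::'f::star_div_algebra)"
  by (simp add: mult.assoc[symmetric] star_mult_self)

text \<open>
  The array \<open>1 - d c d\<^sup>*\<close>. The coefficient \<open>c\<close> sits between \<open>d\<close> and \<open>d\<^sup>*\<close>; it need not be real, so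
  besides reflections (\<open>c = 2 / |d|\<^sup>2\<close>) the family contains maps that multiply \<open>d\<close> by a phase.
\<close>
definition householder :: "(nat \<Rightarrow> 'f) \<Rightarrow> 'f \<Rightarrow> 'f::star_div_algebra arr" where
  "householder d c = (\<lambda>i j. arr_one i j - d i * c * star (d j))"

lemma householder_adj: "arr_adj (householder d c) = householder d (star c)"
  by (intro ext) (simp add: householder_def arr_adj_def arr_one_def star_diff star_mult star_star mult.assoc)

lemma householder_mult:
  assumes d: "\<And>i. p \<le> i \<Longrightarrow> d i = 0"
  shows "arr_mult (householder d c) x i j = x i j - d i * c * (\<Sum>k<p. star (d k) * x k j)"
proof -
  define P where "P = max p (Suc i)"
  have P: "p \<le> P" "i < P" by (auto simp: P_def)
  have "lower_beyond p (householder d c)"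
    by (auto simp: lower_beyond_def householder_def arr_one_def d)
  then have "arr_mult (householder d c) x i j = (\<Sum>k<P. householder d c i k * x k j)"
    using P by (intro arr_mult_eq_sum)
  also have "\<dots> = (\<Sum>k<P. (if k = i then x k j else 0) - d i * c * (star (d k) * x k j))"
    by (intro sum.cong) (auto simp: householder_def arr_one_def algebra_simps)
  also have "\<dots> = x i j - d i * c * (\<Sum>k<P. star (d k) * x k j)"
    using P by (simp add: sum_subtractf sum_distrib_left)
  also have "(\<Sum>k<P. star (d k) * x k j) = (\<Sum>k<p. star (d k) * x k j)"
    using P by (intro sum.mono_neutral_right) (auto simp: d)
  finally show ?thesis .
qed

text \<open>
  For fixed \<open>d\<close> the family is closed under multiplication, since \<open>d\<^sup>* d\<close> is a real number.
\<close>
lemma householder_mult_householder: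
  assumes d: "\<And>i. p \<le> i \<Longrightarrow> d i = 0"
  shows "arr_mult (householder d c) (householder d c') =
    householder d (c + c' - (\<Sum>k<p. (norm (d k))\<^sup>2) *\<^sub>R (c * c'))"
proof (intro ext)
  fix i j
  have "(\<Sum>k<p. star (d k) * householder d c' k j) =
     (\<Sum>k<p. (if k = j then star (d k) else 0) - (norm (d k))\<^sup>2 *\<^sub>R (c' * star (d j)))"
    by (intro sum.cong) (auto simp: householder_def arr_one_def right_diff_distrib
        star_mult_self_left mult.assoc)
  also have "\<dots> = star (d j) - (\<Sum>k<p. (norm (d k))\<^sup>2) *\<^sub>R (c' * star (d j))"
    by (auto simp: sum_subtractf scaleR_sum_left d)
  finally have *: "(\<Sum>k<p. star (d k) * householder d c' k j) =
    star (d j) - (\<Sum>k<p. (norm (d k))\<^sup>2) *\<^sub>R (c' * star (d j))" .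
  show "arr_mult (householder d c) (householder d c') i j =
    householder d (c + c' - (\<Sum>k<p. (norm (d k))\<^sup>2) *\<^sub>R (c * c')) i j"
    unfolding householder_mult[where p=p and d=d, OF d, simplified] * 
    unfolding householder_def by (simp add: householder_def algebra_simps)
qed

lemma householder_zero: "householder d 0 = arr_one"
  by (simp add: householder_def)

text \<open>
  By the product formula both products of \<open>1 - d c d\<^sup>*\<close> with its adjoint \<open>1 - d (star c) d\<^sup>*\<close> have the coefficient
  \<open>c + star c - |d|\<^sup>2 |c|\<^sup>2\<close>, which vanishes under the assumption on \<open>c\<close>.
\<close>
lemma householder_in_Uni:
  assumes d: "\<And>i. p \<le> i \<Longrightarrow> d i = 0"
    and c: "(\<Sum>k<p. (norm (d k))\<^sup>2) * (norm c)\<^sup>2 = 2 * repart c"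
  shows "householder d c \<in> Uni p"
proof -
  have "c + star c - (\<Sum>k<p. (norm (d k))\<^sup>2) *\<^sub>R (c * star c) = 0"
       "star c + c - (\<Sum>k<p. (norm (d k))\<^sup>2) *\<^sub>R (star c * c) = 0"
    unfolding mult_star_self star_mult_self scaleR_scaleR c add.commute[of "star c"] add_star_self
    by simp_all
  then have "arr_mult (householder d c) (householder d (star c)) = arr_one"
    "arr_mult (householder d (star c)) (householder d c) = arr_one"
    by (simp_all add: householder_mult_householder[OF d] householder_zero)
  then show ?thesis
    by (auto simp: Uni_def householder_adj) (auto simp: householder_def d)
qed

section \<open>Gram matrices and unitary orbits\<close>

definition gram :: "'f::star_div_algebra arr \<Rightarrow> 'f arr" where
  "gram x = arr_mult (arr_adj x) x"

lemma gram_eq_sum: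
  assumes "x \<in> Mat p q"
  shows "gram x a b = (\<Sum>i<p. star (x i a) * x i b)"
proof -
  define P where "P = max p (Suc a)"
  have P: "p \<le> P" "a < P" by (auto simp: P_def)
  have "gram x a b = (\<Sum>i<P. star (x i a) * x i b)"
    unfolding gram_def
    by (subst arr_mult_eq_sum[OF lower_beyond_Mat[OF Mat_adj[OF assms] order_refl] P])
       (simp add: arr_adj_def)
  also have "\<dots> = (\<Sum>i<p. star (x i a) * x i b)"
    using P assms by (intro sum.mono_neutral_right) (auto simp: Mat_def)
  finally show ?thesis .
qed

lemma gram_in_Herm:
  assumes "x \<in> Mat p q"
  shows "gram x \<in> Herm q"
proof -
  have "arr_adj (gram x) = gram x"
    by (intro ext) (simp add: gram_eq_sum[OF assms] arr_adj_def star_sum star_mult star_star)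
  moreover have "gram x \<in> Mat q q"
    using assms by (auto simp: gram_eq_sum[OF assms] Mat_def)
  ultimately show ?thesis by (simp add: Herm_def)
qed

lemma gram_Uni_mult:
  assumes k: "k \<in> Uni p" and x: "x \<in> Mat p q"
  shows "gram (arr_mult k x) = gram x"
proof -
  define N where "N = max p q"
  have N: "p \<le> N" "q \<le> N" by (auto simp: N_def)
  note lb = lower_beyond_Uni[OF k N(1)] lower_beyond_Uni[OF Uni_adj[OF k] N(1)]
    lower_beyond_Mat[OF x N(2)] lower_beyond_Mat[OF Mat_adj[OF x] N(1)]
  have "gram (arr_mult k x) = arr_mult (arr_mult (arr_adj x) (arr_adj k)) (arr_mult k x)"
    unfolding gram_def using lb by (simp add: arr_adj_mult[where N=N])
  also have "\<dots> = arr_mult (arr_adj x) (arr_mult (arr_mult (arr_adj k) k) x)"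
    using lb by (simp add: arr_mult_assoc[where N=N])
  finally show ?thesis using k by (simp add: Uni_inverse gram_def)
qed

lemma repart_inverse: "repart (inverse x) = repart x / (norm (x::'f::star_div_algebra))\<^sup>2"
proof (cases "x = 0")
  case False
  then have "inverse x = (1 / (norm x)\<^sup>2) *\<^sub>R star x"
    by (intro inverse_unique) (simp add: mult_star_self)
  then show ?thesis by simp
qed simp

text \<open>
  Let \<open>d = x\<^sub>j - y\<^sub>j\<close> be the difference of the \<open>j\<close>-th columns and \<open>t = d\<^sup>* x\<^sub>j\<close>. The map \<open>1 - d t\<^bsup>-1\<^esup> d\<^sup>*\<close> sends \<open>x\<^sub>j\<close> to
  \<open>x\<^sub>j - d = y\<^sub>j\<close>. It is unitary because \<open>|x\<^sub>j| = |y\<^sub>j|\<close> gives \<open>2 Re t = |d|\<^sup>2\<close>, and it fixes the earlier columns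
  because they have the same products with \<open>x\<^sub>j\<close> and \<open>y\<^sub>j\<close>. The choice of a coefficient that is not real
  is essential here, as \<open>t\<close> itself is not real in general.
\<close>
lemma householder_moves_column:
  assumes x: "x \<in> Mat p q" and y: "y \<in> Mat p q" and eq: "gram x = gram y"
    and agree: "\<And>i c. c < j \<Longrightarrow> x i c = y i c"
  shows "\<exists>k\<in>Uni p. \<forall>i. \<forall>c<Suc j. arr_mult k x i c = y i c"
proof (cases "\<forall>i. x i j = y i j")
  case True
  then show ?thesis
    using agree by (intro bexI[of _ arr_one]) (auto simp: one_in_Uni less_Suc_eq)
next
  case False
  define d where "d = (\<lambda>i. x i j - y i j)"
  define s where "s = (\<Sum>k<p. (norm (d k))\<^sup>2)"
  define t where "t = (\<Sum>k<p. star (d k) * x k j)"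
  have d0: "d i = 0" if "p \<le> i" for i
    using that x y by (simp add: d_def Mat_def)
  have "s \<noteq> 0"
  proof
    assume "s = 0"
    then have "d i = 0" for i
      using d0[of i] by (cases "i < p") (auto simp: s_def sum_nonneg_eq_0_iff)
    with False show False by (simp add: d_def)
  qed
  have "(\<Sum>k<p. (norm (x k j))\<^sup>2) = (\<Sum>k<p. (norm (y k j))\<^sup>2)"
    using arg_cong[OF fun_cong[OF fun_cong[OF eq, of j], of j], of repart]
    by (simp add: gram_eq_sum[OF x] gram_eq_sum[OF y] repart_sum star_mult_self)
  moreover have "(norm (d k))\<^sup>2 = 2 * repart (star (d k) * x k j) + (norm (y k j))\<^sup>2 - (norm (x k j))\<^sup>2" for k
    unfolding power2_norm_eq_inner inner_eq_repart[symmetric] d_def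
    by (simp add: inner_diff_left inner_diff_right inner_commute)
  ultimately have s_t: "s = 2 * repart t"
    by (simp add: s_def t_def repart_sum sum.distrib sum_subtractf sum_distrib_left)
  then have "t \<noteq> 0" using \<open>s \<noteq> 0\<close> by auto
  have k: "householder d (inverse t) \<in> Uni p"
  proof (intro householder_in_Uni d0)
    show "(\<Sum>k<p. (norm (d k))\<^sup>2) * (norm (inverse t))\<^sup>2 = 2 * repart (inverse t)"
      unfolding s_def[symmetric] s_t repart_inverse norm_inverse
      by (simp add: power_inverse divide_inverse)
  qed
  have "arr_mult (householder d (inverse t)) x i c = y i c" if "c < Suc j" for i c
  proof -
    have *: "arr_mult (householder d (inverse t)) x i c =
        x i c - d i * inverse t * (\<Sum>k<p. star (d k) * x k c)"
      by (intro householder_mult d0)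
    show ?thesis
    proof (cases "c = j")
      case True
      have "d i * inverse t * t = d i" using \<open>t \<noteq> 0\<close> by (simp add: mult.assoc)
      then show ?thesis unfolding * unfolding True t_def[symmetric] by (simp add: d_def)
    next
      case False
      then have "c < j" using that by simp
      have "(\<Sum>k<p. star (d k) * x k c) =
          (\<Sum>k<p. star (x k j) * x k c) - (\<Sum>k<p. star (y k j) * y k c)"
        using agree[OF \<open>c < j\<close>] by (simp add: d_def star_diff sum_subtractf algebra_simps)
      also have "\<dots> = 0"
        using fun_cong[OF fun_cong[OF eq, of j], of c]
        by (simp add: gram_eq_sum[OF x] gram_eq_sum[OF y])
      finally show ?thesis unfolding * using agree[OF \<open>c < j\<close>] by simp
    qed
  qed
  with k show ?thesis by blast
qed

text \<open>
  Match the columns one after the other.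
\<close>
lemma gram_eq_imp_Uni_orbit:
  assumes x: "x \<in> Mat p q" and y: "y \<in> Mat p q" and eq: "gram x = gram y"
  shows "\<exists>k\<in>Uni p. arr_mult k x = y"
proof -
  have "\<exists>k\<in>Uni p. \<forall>i. \<forall>c<j. arr_mult k x i c = y i c" for j
  proof (induction j)
    case 0
    then show ?case using one_in_Uni by blast
  next
    case (Suc j)
    then obtain k where k: "k \<in> Uni p" "\<And>i c. c < j \<Longrightarrow> arr_mult k x i c = y i c" by blast
    have "gram (arr_mult k x) = gram y" using gram_Uni_mult[OF k(1) x] eq by simp
    from householder_moves_column[OF Uni_mult_Mat[OF k(1) x] y this k(2)]
    obtain l where l: "l \<in> Uni p" "\<And>i c. c < Suc j \<Longrightarrow> arr_mult l (arr_mult k x) i c = y i c"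
      by blast
    then show ?case
      using Uni_mult[OF l(1) k(1)] by (intro bexI[of _ "arr_mult l k"]) (auto simp: Uni_mult_assoc[OF l(1) k(1)])
  qed
  from this[of q] obtain k where k: "k \<in> Uni p" "\<And>i c. c < q \<Longrightarrow> arr_mult k x i c = y i c" by blast
  have "arr_mult k x i c = y i c" for i c
    using k(2)[of c i] Uni_mult_Mat[OF k(1) x] y by (cases "c < q") (auto simp: Mat_def)
  then show ?thesis using k(1) by blast
qed

section \<open>Compactness of the unitary groups\<close>

lemma compact_Pi_UNIV:
  assumes "\<And>i::'i. compact (S i :: 'b::topological_space set)"
  shows "compact {f. \<forall>i. f i \<in> S i}"
proof -
  have "compactin (product_topology (\<lambda>i::'i. euclidean :: 'b topology) UNIV) (PiE UNIV S)"
    using assms by (subst compactin_PiE) auto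
  then show ?thesis
    by (simp add: euclidean_product_topology PiE_UNIV_domain Pi_def)
qed

lemma compact_bounded_arrays:
  "compact {x :: 'f::star_div_algebra arr. \<forall>i j. norm (x i j) \<le> r}"
proof -
  have "compact {x :: 'f arr. \<forall>i. x i \<in> {y. \<forall>j. y j \<in> cball 0 r}}"
    by (intro compact_Pi_UNIV compact_cball)
  then show ?thesis by simp
qed

lemma continuous_on_arr_entry [continuous_intros]:
  "continuous_on A (\<lambda>x. x i j :: 'f::topological_space)"
proof -
  have "continuous_on UNIV (\<lambda>x. x i j :: 'f)"
    by (rule continuous_on_product_then_coordinatewise) simp
  then show ?thesis by (rule continuous_on_subset) simp
qed

lemma norm_Uni_le_1:
  assumes "u \<in> Uni p"
  shows "norm (u i j) \<le> 1"
proof -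
  define P where "P = max p (Suc (max i j))"
  have P: "p \<le> P" "i < P" "j < P" by (auto simp: P_def)
  have "1 = repart (arr_mult u (arr_adj u) i i)"
    using assms by (simp add: Uni_inverse arr_one_def)
  also have "\<dots> = (\<Sum>k<P. (norm (u i k))\<^sup>2)"
    unfolding arr_mult_eq_sum[OF lower_beyond_Uni[OF assms order_refl] P(1,2)]
    by (simp add: arr_adj_def repart_sum mult_star_self)
  finally have "(norm (u i j))\<^sup>2 \<le> 1\<^sup>2"
    using member_le_sum[of j "{..<P}" "\<lambda>k. (norm (u i k))\<^sup>2"] P by simp
  then show ?thesis by (rule power2_le_imp_le) simp
qed

text \<open>
  A closed set of arrays with bounded entries, which is compact by the theorem of Tychonoff. Closedness
  needs the unitarity equations as finite sums; on arrays with the right padding, products are such sums.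
\<close>
lemma compact_Uni: "compact (Uni p :: 'f::star_div_algebra arr set)"
proof -
  let ?P = "\<lambda>i. max p (Suc i)"
  have pad: "lower_beyond p u" "lower_beyond p (arr_adj u)"
    if "\<forall>i j. i \<ge> p \<or> j \<ge> p \<longrightarrow> u i j = arr_one i j" for u :: "'f arr"
    using that by (auto simp: lower_beyond_def arr_adj_def arr_one_def)
  have "Uni p = {u :: 'f arr. (\<forall>i j. i \<ge> p \<or> j \<ge> p \<longrightarrow> u i j = arr_one i j) \<and>
      (\<forall>i j. (\<Sum>k<?P i. u i k * star (u j k)) = arr_one i j) \<and>
      (\<forall>i j. (\<Sum>k<?P i. star (u k i) * u k j) = arr_one i j)}" (is "_ = ?S")
  proof (intro set_eqI)
    fix u :: "'f arr"
    show "u \<in> Uni p \<longleftrightarrow> u \<in> ?S"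
    proof (cases "\<forall>i j. i \<ge> p \<or> j \<ge> p \<longrightarrow> u i j = arr_one i j")
      case True
      have "arr_mult u (arr_adj u) i j = (\<Sum>k<?P i. u i k * star (u j k))"
        "arr_mult (arr_adj u) u i j = (\<Sum>k<?P i. star (u k i) * u k j)" for i j
        using arr_mult_eq_sum[OF pad(1)[OF True], of "?P i" i] arr_mult_eq_sum[OF pad(2)[OF True], of "?P i" i]
        by (simp_all add: arr_adj_def)
      then show ?thesis unfolding Uni_def using True by (simp add: fun_eq_iff)
    qed (auto simp: Uni_def)
  qed
  moreover have "closed ?S"
    by (intro closed_Collect_conj closed_Collect_all closed_Collect_imp open_Collect_const
        closed_Collect_eq continuous_intros)
  ultimately have "closed (Uni p :: 'f arr set)" by simp
  then have "compact ({u :: 'f arr. \<forall>i j. norm (u i j) \<le> 1} \<inter> Uni p)"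
    by (intro compact_Int_closed compact_bounded_arrays)
  moreover have "{u. \<forall>i j. norm (u i j) \<le> 1} \<inter> Uni p = (Uni p :: 'f arr set)"
    using norm_Uni_le_1 by blast
  ultimately show ?thesis by simp
qed

section \<open>Polar decomposition\<close>

text \<open>
  The quadratic form \<open>d\<^sup>* z d\<close> measures the effect of a rank one perturbation on the trace. At a matrix
  \<open>y\<close> whose real trace is maximal in its \<open>U\<^sub>p\<close>-orbit this gives information on \<open>y\<close>; the following lemmas
  deduce that \<open>y\<close> is Hermitian and positive semidefinite.
\<close>
lemma trace_householder_mult:
  assumes d: "\<And>i. p \<le> i \<Longrightarrow> d i = 0"
  shows "(\<Sum>i<p. repart (arr_mult (householder d c) z i i)) =
    (\<Sum>i<p. repart (z i i)) - repart (c * (\<Sum>l<p. \<Sum>i<p. star (d l) * z l i * d i))"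
proof -
  have "repart (d i * c * (\<Sum>l<p. star (d l) * z l i)) =
      repart (c * (\<Sum>l<p. star (d l) * z l i * d i))" for i
    using repart_mult_commute[of "d i" "c * (\<Sum>l<p. star (d l) * z l i)"]
    by (simp add: mult.assoc sum_distrib_right)
  then have "(\<Sum>i<p. repart (arr_mult (householder d c) z i i)) =
    (\<Sum>i<p. repart (z i i)) - (\<Sum>i<p. repart (c * (\<Sum>l<p. star (d l) * z l i * d i)))"
    by (simp add: householder_mult[where d=d and p=p, OF d, simplified] sum_subtractf)
  also have "(\<Sum>i<p. repart (c * (\<Sum>l<p. star (d l) * z l i * d i))) =
     repart (c * (\<Sum>i<p. \<Sum>l<p. star (d l) * z l i * d i))"
    by (simp add: sum_distrib_left repart_sum)
  also have "(\<Sum>i<p. \<Sum>l<p. star (d l) * z l i * d i) = (\<Sum>l<p. \<Sum>i<p. star (d l) * z l i * d i)"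
    by (rule sum.swap)
  finally show ?thesis .
qed

text \<open>
  The reflection at the hyperplane orthogonal to \<open>d\<close> does not increase the real trace.
\<close>
lemma trace_maximal_imp_nonneg:
  assumes max: "\<And>u. u \<in> Uni p \<Longrightarrow> (\<Sum>i<p. repart (arr_mult u y i i)) \<le> (\<Sum>i<p. repart (y i i))"
    and d: "\<And>i. p \<le> i \<Longrightarrow> d i = 0"
  shows "0 \<le> repart (\<Sum>l<p. \<Sum>i<p. star (d l) * y l i * d i)" (is "0 \<le> repart ?Q")
proof -
  define s where "s = (\<Sum>k<p. (norm (d k))\<^sup>2)"
  show ?thesis
  proof (cases "s = 0")
    case True
    then have "d i = 0" for i
      using d[of i] by (cases "i < p") (auto simp: s_def sum_nonneg_eq_0_iff)
    then show ?thesis by simp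
  next
    case False
    moreover have "0 \<le> s" by (simp add: s_def sum_nonneg)
    ultimately have s: "0 < s" by simp
    have "householder d ((2 / s) *\<^sub>R 1) \<in> Uni p"
    proof (intro householder_in_Uni d)
      show "(\<Sum>k<p. (norm (d k))\<^sup>2) * (norm ((2 / s) *\<^sub>R (1::'a)))\<^sup>2 = 2 * repart ((2 / s) *\<^sub>R (1::'a))"
        unfolding s_def[symmetric] using s by (simp add: power2_eq_square)
    qed
    from max[OF this] have "0 \<le> (2 / s) * repart ?Q"
      by (simp add: trace_householder_mult[where d=d and p=p, OF d, simplified])
    then show ?thesis using s by (simp add: zero_le_mult_iff zero_le_divide_iff)
  qed
qed

text \<open>
  Multiply the \<open>m\<close>-th row by the phase \<open>l\<close> that turns the diagonal entry into its norm. By maximality the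
  norm does not exceed the real part.
\<close>
lemma trace_maximal_imp_diagonal_real:
  assumes max: "\<And>u. u \<in> Uni p \<Longrightarrow> (\<Sum>i<p. repart (arr_mult u y i i)) \<le> (\<Sum>i<p. repart (y i i))"
    and m: "m < p"
  shows "star (y m m) = y m m"
proof -
  obtain l where l: "norm l = 1" "l * y m m = norm (y m m) *\<^sub>R 1"
    using exists_unit_rotating_to_norm by blast
  define d where "d = (\<lambda>i. if i = m then 1 else 0 :: 'a)"
  have d: "d i = 0" if "p \<le> i" for i using that m by (auto simp: d_def)
  have "(norm (1 - l))\<^sup>2 = 2 * repart (1 - l)"
  proof -
    have "inner l l = 1" "inner 1 (1::'a) = 1" using l(1) by (simp_all add: dot_square_norm)
    then show ?thesis
      unfolding power2_norm_eq_inner repart_eq_inner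
      by (simp only: inner_diff_left inner_diff_right inner_commute[of l 1]) simp
  qed
  moreover have "(\<Sum>k<p. (norm (d k))\<^sup>2) = 1"
    using m by (simp add: d_def if_distrib[of norm] if_distrib[of "\<lambda>x. x\<^sup>2"] cong: if_cong)
  ultimately have "householder d (1 - l) \<in> Uni p"
    by (intro householder_in_Uni d) simp_all
  from max[OF this]
  have "0 \<le> repart ((1 - l) * (\<Sum>l<p. \<Sum>i<p. star (d l) * y l i * d i))"
    by (simp add: trace_householder_mult[where d=d and p=p, OF d, simplified])
  also have "(\<Sum>l<p. \<Sum>i<p. star (d l) * y l i * d i) = y m m"
    using m by (simp add: d_def if_distrib[of star] if_distrib[of "\<lambda>x. x * _"] if_distrib[of "\<lambda>x. _ * x"] cong: if_cong)
  finally have "norm (y m m) \<le> repart (y m m)"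
    using l(2) by (simp add: left_diff_distrib)
  then show ?thesis by (rule star_eq_if_norm_le_repart)
qed

text \<open>
  A function with a maximum at \<open>0\<close> has derivative \<open>0\<close> there.
\<close>
lemma linear_le_quadratic_imp_zero:
  assumes "\<And>t::real. t * D \<le> t\<^sup>2 * A"
  shows "D = 0"
proof -
  define B where "B = \<bar>A\<bar> + 1"
  have B: "0 < B" "A \<le> B - 1" by (auto simp: B_def)
  have "D / B * D \<le> (D / B)\<^sup>2 * A" by (rule assms)
  then have "D\<^sup>2 * B \<le> D\<^sup>2 * A" using B by (simp add: field_simps power2_eq_square)
  also have "\<dots> \<le> D\<^sup>2 * (B - 1)" using B by (intro mult_left_mono) auto
  finally show ?thesis by (simp add: algebra_simps)
qed

text \<open>
  A single reflection only sees the form \<open>d\<^sup>* y d\<close>, which over the reals does not detect the antisymmetric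
  part of \<open>y\<close>. The product of the reflections in \<open>e\<^sub>m\<close> and \<open>e\<^sub>m + t w e\<^sub>n\<close> is a rotation in the plane of the
  two coordinates, up to first order in \<open>t\<close> by the angle \<open>2 t\<close>; vanishing of the first variation of the trace
  gives \<open>Re (w\<^sup>* y\<^sub>n\<^sub>m) = Re (y\<^sub>m\<^sub>n w)\<close> for all units \<open>w\<close>.
\<close>
lemma trace_maximal_imp_hermitian:
  fixes y :: "'f::star_div_algebra arr"
  assumes max: "\<And>u. u \<in> Uni p \<Longrightarrow> (\<Sum>i<p. repart (arr_mult u y i i)) \<le> (\<Sum>i<p. repart (y i i))"
    and m: "m < p" and n: "n < p" and "m \<noteq> n"
  shows "star (y n m) = y m n"
proof -
  define D where "D = star (y n m) - y m n"
  obtain w where w: "norm w = 1" "D * w = norm D *\<^sub>R 1"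
    using exists_unit_rotating_to_norm by blast
  have "repart (star w * y n m) - repart (y m n * w) = 0"
  proof (rule linear_le_quadratic_imp_zero)
    fix t :: real
    define e :: "nat \<Rightarrow> 'f" where "e = (\<lambda>i. if i = m then 1 else 0)"
    define d where "d = (\<lambda>i. (if i = m then 1 else 0) + (if i = n then t *\<^sub>R w else 0))"
    \<comment> \<open>The factor that makes \<open>householder d c\<close> a reflection, as \<open>|d|\<^sup>2 = 1 + t\<^sup>2\<close>.\<close>
    define c where "c = 2 / (1 + t\<^sup>2)"
    have e0: "e i = 0" and d0: "d i = 0" if "p \<le> i" for i
      using that m n by (auto simp: e_def d_def)
    have sum_e: "(\<Sum>l<p. star (e l) * g l) = g m" "(\<Sum>l<p. g l * e l) = g m" for g
      using m by (simp_all add: e_def if_distrib[of star] if_distrib[of "\<lambda>x. x * _"] if_distrib[of "\<lambda>x. _ * x"] cong: if_cong)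
    have sum_d: "(\<Sum>l<p. star (d l) * g l) = g m + t *\<^sub>R (star w * g n)"
      "(\<Sum>l<p. g l * d l) = g m + t *\<^sub>R (g n * w)" for g
      using m n by (simp_all add: d_def star_add distrib_left distrib_right sum.distrib star_scaleR
          if_distrib[of star] if_distrib[of "\<lambda>x. x * _"] if_distrib[of "\<lambda>x. _ * x"] cong: if_cong)
    have norm_e: "(\<Sum>k<p. (norm (e k))\<^sup>2) = 1"
      using sum_e(1)[of e] by (simp add: repart_mult_star_self[symmetric] repart_sum[symmetric] e_def)
    have "(\<Sum>k<p. (norm (d k))\<^sup>2) = repart (d m + t *\<^sub>R (star w * d n))"
      unfolding sum_d(1)[of d, symmetric] by (simp add: repart_mult_star_self repart_sum)
    also have "\<dots> = 1 + t\<^sup>2"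
      using \<open>m \<noteq> n\<close> w(1) by (simp add: d_def repart_mult_star_self power2_eq_square)
    finally have norm_d: "(\<Sum>k<p. (norm (d k))\<^sup>2) = 1 + t\<^sup>2" .
    have t: "0 < 1 + t\<^sup>2" by (rule add_pos_nonneg) simp_all
    have he: "householder e (2 *\<^sub>R 1) \<in> Uni p"
      by (intro householder_in_Uni e0) (simp_all add: norm_e)
    have hd: "householder d (c *\<^sub>R 1) \<in> Uni p"
    proof (intro householder_in_Uni d0)
      show "(\<Sum>k<p. (norm (d k))\<^sup>2) * (norm (c *\<^sub>R (1::'f)))\<^sup>2 = 2 * repart (c *\<^sub>R (1::'f))"
      proof -
        have "r * (norm ((2 / r) *\<^sub>R (1::'f)))\<^sup>2 = 2 * repart ((2 / r) *\<^sub>R (1::'f))"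
          if "0 < r" for r :: real
          using that by (simp add: power2_eq_square)
        then show ?thesis unfolding norm_d c_def using t by blast
      qed
    qed
    define z where "z = arr_mult (householder d (c *\<^sub>R 1)) y"
    have z_mm: "z m m = y m m - c *\<^sub>R (y m m + t *\<^sub>R (star w * y n m))"
      unfolding z_def householder_mult[where d=d and p=p, OF d0, simplified] sum_d
      using \<open>m \<noteq> n\<close> by (simp add: d_def)
    have "(\<Sum>i<p. repart (arr_mult (arr_mult (householder e (2 *\<^sub>R 1)) (householder d (c *\<^sub>R 1))) y i i)) =
       (\<Sum>i<p. repart (z i i)) - 2 * repart (z m m)"
      unfolding Uni_mult_assoc[OF he hd] z_def[symmetric]
        trace_householder_mult[where d=e and p=p, OF e0, simplified] sum_e by simp
    also have "(\<Sum>i<p. repart (z i i)) = (\<Sum>i<p. repart (y i i)) -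
        c * repart (y m m + t *\<^sub>R (y m n * w) + t *\<^sub>R (star w * (y n m + t *\<^sub>R (y n n * w))))"
      unfolding z_def trace_householder_mult[where d=d and p=p, OF d0, simplified] mult.assoc
        sum_distrib_left[symmetric] sum_d by simp
    finally have "0 \<le> c * repart (y m m + t *\<^sub>R (y m n * w) + t *\<^sub>R (star w * (y n m + t *\<^sub>R (y n n * w))))
        + 2 * repart (z m m)"
      using max[OF Uni_mult[OF he hd]] by linarith
    then have "0 \<le> c * (repart (y m m) + t * repart (y m n * w)
        + t * (repart (star w * y n m) + t * repart (star w * (y n n * w))))
        + 2 * (repart (y m m) - c * (repart (y m m) + t * repart (star w * y n m)))"
      (is "0 \<le> c * ?A + 2 * (_ - c * ?B)")
      unfolding z_mm by (simp add: distrib_left)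
    then have "0 \<le> (c * ?A + 2 * (repart (y m m) - c * ?B)) * (1 + t\<^sup>2)"
      using t by (intro mult_nonneg_nonneg) auto
    also have "\<dots> = (c * (1 + t\<^sup>2)) * ?A + 2 * ((1 + t\<^sup>2) * repart (y m m)) - 2 * ((c * (1 + t\<^sup>2)) * ?B)"
      by algebra
    also have "c * (1 + t\<^sup>2) = 2" using t unfolding c_def by (intro nonzero_eq_divide_eq[THEN iffD1]) simp_all
    finally have "0 \<le> ?A + (1 + t\<^sup>2) * repart (y m m) - 2 * ?B" by simp
    then show "t * (repart (star w * y n m) - repart (y m n * w)) \<le>
        t\<^sup>2 * (repart (y m m) + repart (star w * (y n n * w)))"
      by (simp add: algebra_simps power2_eq_square)
  qed
  moreover have "repart (star w * y n m) = repart (star (y n m) * w)"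
    using repart_star[of "star w * y n m"] by (simp add: star_mult star_star)
  ultimately have "repart (D * w) = 0" by (simp add: D_def left_diff_distrib)
  then have "D = 0" using w(2) by simp
  then show ?thesis by (simp add: D_def)
qed

text \<open>
  Maximize the real trace of \<open>k x\<close> over the compact group \<open>U\<^sub>p\<close>. A maximizer \<open>y = k x\<close> is Hermitian as a
  \<open>p \<times> p\<close>-matrix; as its columns from \<open>q\<close> on vanish, so do its rows.
\<close>
theorem polar_decomposition:
  assumes x: "x \<in> Mat p q" and "q \<le> p"
  shows "\<exists>k\<in>Uni p. arr_mult k x \<in> Psd q"
proof -
  let ?T = "\<lambda>u. \<Sum>i<p. repart (\<Sum>k<p. u i k * x k i)"
  have "continuous_on (Uni p) ?T"
    by (intro continuous_on_sum continuous_on_repart continuous_on_mult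
        continuous_on_arr_entry continuous_on_const)
  then obtain k where k: "k \<in> Uni p" and max: "\<And>u. u \<in> Uni p \<Longrightarrow> ?T u \<le> ?T k"
    using continuous_attains_sup[OF compact_Uni, of p ?T] one_in_Uni by blast
  define y where "y = arr_mult k x"
  have yM: "y \<in> Mat p q" unfolding y_def by (rule Uni_mult_Mat[OF k x])
  have T: "?T u = (\<Sum>i<p. repart (arr_mult u x i i))" if "u \<in> Uni p" for u
    by (intro sum.cong refl) (simp add: Uni_mult_eq_sum[OF that])
  have max': "(\<Sum>i<p. repart (arr_mult u y i i)) \<le> (\<Sum>i<p. repart (y i i))" if u: "u \<in> Uni p" for u
    using max[OF Uni_mult[OF u k]] unfolding T[OF Uni_mult[OF u k]] T[OF k]
    by (simp add: y_def Uni_mult_assoc[OF u k])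
  have herm: "star (y j i) = y i j" for i j
  proof (cases "i < p \<and> j < p")
    case True
    then show ?thesis
      using trace_maximal_imp_diagonal_real[OF max'] trace_maximal_imp_hermitian[OF max']
      by (cases "i = j") auto
  next
    case False
    then show ?thesis using yM \<open>q \<le> p\<close> by (auto simp: Mat_def)
  qed
  have "y i j = 0" if "q \<le> i \<or> q \<le> j" for i j
    using that yM herm[of i j] by (auto simp: Mat_def)
  then have yq: "y \<in> Herm q"
    using herm by (auto simp: Herm_def Mat_def arr_adj_def)
  have "0 \<le> repart (\<Sum>i<q. \<Sum>j<q. star (v i) * y i j * v j)" for v
  proof -
    define d where "d = (\<lambda>i. if i < q then v i else 0)"
    have "(\<Sum>i<q. \<Sum>j<q. star (v i) * y i j * v j) = (\<Sum>i<q. \<Sum>j<q. star (d i) * y i j * d j)"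
      by (intro sum.cong) (auto simp: d_def)
    also have "\<dots> = (\<Sum>i<p. \<Sum>j<p. star (d i) * y i j * d j)"
      using \<open>q \<le> p\<close> by (intro sum.mono_neutral_cong_left ballI sum.neutral) (auto simp: d_def)
    finally show ?thesis
      using trace_maximal_imp_nonneg[OF max', of d] \<open>q \<le> p\<close> by (simp add: d_def)
  qed
  then have "y \<in> Psd q" using yq by (simp add: Psd_def)
  with k show ?thesis unfolding y_def by blast
qed

section \<open>Second moments of Haar measure\<close>

lemma continuous_on_arrI:
  assumes "\<And>i j. continuous_on S (\<lambda>s. f s i j)"
  shows "continuous_on S f"
  using assms by (intro continuous_on_coordinatewise_then_product)

lemma continuous_on_arrD:
  assumes "continuous_on S f"
  shows "continuous_on S (\<lambda>s. f s i j)"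
  by (rule continuous_on_compose2[OF continuous_on_arr_entry[of UNIV] assms]) simp

lemma continuous_on_Uni_mult:
  fixes B :: "'s::topological_space \<Rightarrow> 'f::star_div_algebra arr"
  assumes A: "continuous_on S A" "\<And>s. s \<in> S \<Longrightarrow> A s \<in> Uni p" and B: "continuous_on S B"
  shows "continuous_on S (\<lambda>s. arr_mult (A s) (B s))"
proof (rule continuous_on_arrI)
  fix i j
  show "continuous_on S (\<lambda>s. arr_mult (A s) (B s) i j)"
  proof (cases "i < p")
    case True
    have "continuous_on S (\<lambda>s. \<Sum>k<p. A s i k * B s k j)"
      by (intro continuous_on_sum continuous_on_mult continuous_on_arrD[OF A(1)] continuous_on_arrD[OF B])
    then show ?thesis
      by (rule continuous_on_eq) (simp add: Uni_mult_eq_sum[OF A(2)] True)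
  next
    case False
    have "continuous_on S (\<lambda>s. B s i j)" by (rule continuous_on_arrD[OF B])
    then show ?thesis
      by (rule continuous_on_eq) (use False in \<open>simp add: Uni_mult_row[OF A(2)]\<close>)
  qed
qed

lemma continuous_on_snd_K: "continuous_on S (snd :: 'f::star_div_algebra elt \<Rightarrow> _)"
  using continuous_on_snd[OF continuous_on_id[of S]] by simp

lemma K_snd: "k \<in> K p \<Longrightarrow> snd k \<in> Uni p" and K_fst: "k \<in> K p \<Longrightarrow> fst k = arr_zero"
  by (auto simp: K_def)

lemma normalized_haar_space: "normalized_haar p \<mu> \<Longrightarrow> space \<mu> = K p"
  using sets_eq_imp_space_eq[of \<mu> "restrict_space borel (K p)"]
  by (simp add: normalized_haar_def space_restrict_space)

lemma normalized_haar_measurable: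
  fixes f :: "'f::star_div_algebra elt \<Rightarrow> 'b::topological_space"
  assumes "normalized_haar p \<mu>" "continuous_on (K p) f"
  shows "f \<in> borel_measurable \<mu>"
proof -
  have "(borel_measurable \<mu> :: ('f elt \<Rightarrow> 'b) set) = borel_measurable (restrict_space borel (K p))"
    using assms(1) by (intro measurable_cong_sets) (simp_all add: normalized_haar_def)
  then show ?thesis using borel_measurable_continuous_on_restrict[OF assms(2)] by simp
qed

lemma normalized_haar_integrable:
  fixes f :: "'f::star_div_algebra elt \<Rightarrow> 'b::{banach, second_countable_topology}"
  assumes \<mu>: "normalized_haar p \<mu>" and f: "continuous_on (K p) f" and b: "\<And>k. k \<in> K p \<Longrightarrow> norm (f k) \<le> B"
  shows "integrable \<mu> f"
proof -
  interpret prob_space \<mu> using \<mu> by (simp add: normalized_haar_def)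
  show ?thesis
    using b by (intro integrable_const_bound[where B=B] normalized_haar_measurable[OF \<mu> f] AE_I2)
      (simp add: normalized_haar_space[OF \<mu>])
qed

lemma gmult_K:
  assumes "k \<in> K p" "l \<in> K p"
  shows "gmult k l = (arr_zero, arr_mult (snd k) (snd l))"
  using assms by (simp add: gmult_def K_fst)

text \<open>
  Invariance is given for images of measurable sets under left translation. Translation is
  continuous, hence measurable, and has a translation as its inverse, so the image measure is the same measure.
\<close>
lemma normalized_haar_integral_left:
  fixes f :: "'f::star_div_algebra elt \<Rightarrow> real"
  assumes \<mu>: "normalized_haar p \<mu>" and k: "k \<in> K p" and f: "f \<in> borel_measurable \<mu>"
  shows "(LINT l|\<mu>. f (gmult k l)) = (LINT l|\<mu>. f l)"
proof -
  have in_K: "gmult k l \<in> K p" if "l \<in> K p" for l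
    using that k by (auto simp: gmult_K K_def intro: Uni_mult)
  have "continuous_on (K p) (\<lambda>l. (arr_zero, arr_mult (snd k) (snd l)) :: 'f elt)"
    using k by (intro continuous_on_Pair continuous_on_const continuous_on_Uni_mult[where p=p]
        continuous_on_snd_K) (auto simp: K_snd)
  then have "continuous_on (K p) (gmult k)"
    by (rule continuous_on_eq) (simp add: gmult_K[OF k])
  then have "gmult k \<in> measurable \<mu> borel" by (rule normalized_haar_measurable[OF \<mu>])
  then have "gmult k \<in> measurable \<mu> (restrict_space borel (K p))"
    using in_K by (intro measurable_restrict_space2) (auto simp: normalized_haar_space[OF \<mu>])
  then have meas: "gmult k \<in> measurable \<mu> \<mu>"
    using \<mu> measurable_cong_sets[of \<mu> \<mu> \<mu> "restrict_space borel (K p)"]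
    by (simp add: normalized_haar_def)
  have "distr \<mu> \<mu> (gmult k) = \<mu>"
  proof (rule measure_eqI)
    fix A assume "A \<in> sets (distr \<mu> \<mu> (gmult k))"
    then have A: "A \<in> sets \<mu>" by simp
    then have AK: "A \<subseteq> K p" using sets.sets_into_space normalized_haar_space[OF \<mu>] by blast
    define B where "B = gmult k -` A \<inter> space \<mu>"
    have B: "B \<in> sets \<mu>" unfolding B_def by (rule measurable_sets[OF meas A])
    have "a \<in> gmult k ` B" if "a \<in> A" for a
    proof
      let ?b = "(arr_zero, arr_mult (arr_adj (snd k)) (snd a))"
      have a: "a \<in> K p" using that AK by blast
      have b: "?b \<in> K p"
        using a k by (auto simp: K_def intro!: Uni_mult Uni_adj)
      show eq: "a = gmult k ?b"
        using a k unfolding gmult_K[OF k b]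
        by (simp add: Uni_mult_assoc[OF K_snd[OF k] Uni_adj[OF K_snd[OF k]], symmetric]
            Uni_inverse[OF K_snd[OF k]] prod_eq_iff K_fst)
      show "?b \<in> B" unfolding B_def using b eq[symmetric] that by (simp add: normalized_haar_space[OF \<mu>])
    qed
    then have "gmult k ` B = A" by (auto simp: B_def)
    moreover have "emeasure \<mu> (gmult k ` B) = emeasure \<mu> B"
      using \<mu> k B unfolding normalized_haar_def by blast
    ultimately show "emeasure (distr \<mu> \<mu> (gmult k)) A = emeasure \<mu> A"
      unfolding emeasure_distr[OF meas A] B_def[symmetric] by simp
  qed simp
  then show ?thesis using integral_distr[OF meas f] by simp
qed

lemma continuous_on_K_entry: "continuous_on S (\<lambda>k :: 'f::star_div_algebra elt. snd k i j)"
  by (rule continuous_on_arrD[OF continuous_on_snd_K])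

text \<open>
  The moment does not depend on the row \<open>i\<close>, by invariance under the exchange of two rows, and the squares in
  a column of a unitary matrix sum to \<open>1\<close>.
\<close>
lemma normalized_haar_second_moment:
  fixes \<mu> :: "'f::star_div_algebra elt measure"
  assumes \<mu>: "normalized_haar p \<mu>" and i: "i < p" and j: "j < p"
  shows "integrable \<mu> (\<lambda>k. (norm (snd k i j))\<^sup>2)" "(LINT k|\<mu>. (norm (snd k i j))\<^sup>2) = 1 / p"
proof -
  interpret prob_space \<mu> using \<mu> by (simp add: normalized_haar_def)
  define m where "m = (\<lambda>l. LINT k|\<mu>. (norm (snd k l j))\<^sup>2)"
  have cont: "continuous_on (K p) (\<lambda>k. (norm (snd k l j))\<^sup>2)" for l
    by (intro continuous_on_power continuous_on_norm continuous_on_K_entry)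
  have int: "integrable \<mu> (\<lambda>k. (norm (snd k l j))\<^sup>2)" for l
    using power_le_one[OF norm_ge_zero norm_Uni_le_1[OF K_snd], where n=2]
    by (intro normalized_haar_integrable[OF \<mu>, where B=1] cont) auto
  then show "integrable \<mu> (\<lambda>k. (norm (snd k i j))\<^sup>2)" .
  have "m l = m i" if l: "l < p" for l
  proof (cases "l = i")
    case False
    \<comment> \<open>As \<open>|d|\<^sup>2 = 2\<close>, the coefficient \<open>1\<close> gives the reflection that exchanges the rows \<open>i\<close> and \<open>l\<close>.\<close>
    define d where "d = (\<lambda>a. (if a = i then 1 else 0) - (if a = l then 1 else 0) :: 'f)"
    have d0: "d a = 0" if "p \<le> a" for a using that i l by (auto simp: d_def)
    have sum_d: "(\<Sum>a<p. star (d a) * g a) = g i - g l" for g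
      using i l by (simp add: d_def star_diff left_diff_distrib sum_subtractf if_distrib[of star]
          if_distrib[of "\<lambda>x. x * _"] cong: if_cong)
    have "(\<Sum>a<p. (norm (d a))\<^sup>2) = 2"
      using sum_d[of d] False repart_simps(3)[of "1::'f" 1]
      by (simp add: repart_mult_star_self[symmetric] repart_sum[symmetric] d_def)
    then have h: "(arr_zero, householder d 1) \<in> K p"
      unfolding K_def by (auto intro!: householder_in_Uni d0)
    have "m i = (LINT k|\<mu>. (norm (snd (gmult (arr_zero, householder d 1) k) i j))\<^sup>2)"
      unfolding m_def using normalized_haar_measurable[OF \<mu> cont]
      by (intro normalized_haar_integral_left[OF \<mu> h, symmetric])
    also have "\<dots> = m l"
      unfolding m_def gmult_def using False
      by (simp add: householder_mult[where d=d and p=p, OF d0, simplified] sum_d) (simp add: d_def)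
    finally show ?thesis ..
  qed simp
  then have "p * m i = (\<Sum>l<p. m l)" by simp
  also have "\<dots> = (LINT k|\<mu>. (\<Sum>l<p. (norm (snd k l j))\<^sup>2))"
    unfolding m_def using int by (simp add: Bochner_Integration.integral_sum)
  also have "\<dots> = (LINT k|\<mu>. 1)"
  proof (rule Bochner_Integration.integral_cong)
    fix k assume "k \<in> space \<mu>"
    then have k: "snd k \<in> Uni p" by (simp add: normalized_haar_space[OF \<mu>] K_snd)
    have "(\<Sum>l<p. (norm (snd k l j))\<^sup>2) = repart (arr_mult (arr_adj (snd k)) (snd k) j j)"
      unfolding Uni_mult_eq_sum[OF Uni_adj[OF k] j]
      by (simp add: arr_adj_def repart_sum repart_mult_star_self)
    then show "(\<Sum>l<p. (norm (snd k l j))\<^sup>2) = 1" using k by (simp add: Uni_inverse arr_one_def)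
  qed simp
  also have "\<dots> = 1" by (simp add: prob_space)
  finally show "(LINT k|\<mu>. (norm (snd k i j))\<^sup>2) = 1 / p"
    using i by (simp add: m_def field_simps)
qed

section \<open>Biinvariant functions as functions of the Gram matrix\<close>

lemma continuous_on_G:
  assumes \<phi>: "continuous_map (Ginf_topology q) euclidean \<phi>" and "q \<le> p"
  shows "continuous_on (G q p) (\<phi> :: 'f::star_div_algebra elt \<Rightarrow> complex)"
proof -
  have sub: "G q p \<subseteq> (Ginf q :: 'f elt set)" if "q \<le> p" for p using that by (auto simp: Ginf_def)
  have "openin (Ginf_topology q) (Ginf q :: 'f elt set)"
    unfolding openin_Ginf_topology
  proof (intro conjI allI impI order_refl)
    fix p assume "q \<le> p"
    then have "Ginf q \<inter> G q p = (G q p :: 'f elt set)" using sub by blast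
    then show "openin (top_of_set (G q p)) (Ginf q \<inter> G q p :: 'f elt set)" by simp
  qed
  then have top: "topspace (Ginf_topology q) = (Ginf q :: 'f elt set)"
    unfolding topspace_def by (auto simp: openin_Ginf_topology)
  have "continuous_map (top_of_set (G q p)) euclidean \<phi>"
    unfolding continuous_map_alt
  proof (intro conjI allI impI)
    fix U :: "complex set" assume "openin euclidean U"
    then have "openin (Ginf_topology q) (\<phi> -` U \<inter> Ginf q)"
      using \<phi> unfolding continuous_map_alt top by blast
    then have "openin (top_of_set (G q p)) (\<phi> -` U \<inter> Ginf q \<inter> G q p)"
      using \<open>q \<le> p\<close> unfolding openin_Ginf_topology by blast
    moreover have "\<phi> -` U \<inter> Ginf q \<inter> G q p = \<phi> -` U \<inter> topspace (top_of_set (G q p))"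
      using sub[OF \<open>q \<le> p\<close>] by auto
    ultimately show "openin (top_of_set (G q p)) (\<phi> -` U \<inter> topspace (top_of_set (G q p)))"
      by simp
  qed auto
  then show ?thesis by simp
qed

locale biinvariant_function =
  fixes q :: nat and \<phi> :: "'f::star_div_algebra elt \<Rightarrow> complex"
  assumes continuous: "continuous_map (Ginf_topology q) euclidean \<phi>"
    and biinvariant: "K_biinvariant q \<phi>"
begin

text \<open>
  The right translation by the inverse of \<open>k u\<close> removes the unitary component.
\<close>
lemma phi_orbit:
  assumes "q \<le> p" "x \<in> Mat p q" "u \<in> Uni p" "k \<in> Uni p"
  shows "\<phi> (x, u) = \<phi> (g_elt (arr_mult k x))"
proof -
  let ?l = "arr_adj (arr_mult k u)"
  have ku: "arr_mult k u \<in> Uni p" using assms by (simp add: Uni_mult)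
  have "(arr_zero, k) \<in> Kinf q" "(arr_zero, ?l) \<in> Kinf q"
    using assms Uni_adj[OF ku] by (auto simp: Kinf_def K_def)
  moreover have "(x, u) \<in> Ginf q" using assms by (auto simp: Ginf_def G_def)
  ultimately have "\<phi> (gmult (gmult (arr_zero, k) (x, u)) (arr_zero, ?l)) = \<phi> (x, u)"
    using biinvariant unfolding K_biinvariant_def by blast
  then show ?thesis by (simp add: gmult_def g_elt_def Uni_inverse(1)[OF ku])
qed

lemma phi_eq_if_gram_eq:
  assumes "x \<in> Mat p q" "y \<in> Mat p' q" "gram x = gram y"
  shows "\<phi> (g_elt x) = \<phi> (g_elt y)"
proof -
  define P where "P = max q (max p p')"
  have "q \<le> P" "x \<in> Mat P q" "y \<in> Mat P q"
    using assms(1,2) by (auto simp: P_def intro: Mat_mono)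
  moreover from this obtain k where "k \<in> Uni P" "arr_mult k x = y"
    using gram_eq_imp_Uni_orbit assms(3) by blast
  ultimately show ?thesis
    using phi_orbit[of P x arr_one k] by (simp add: one_in_Uni g_elt_def)
qed

lemma phi_polar:
  assumes "x \<in> Mat p q"
  obtains a where "a \<in> Psd q" "gram a = gram x" "\<phi> (g_elt x) = \<phi> (g_elt a)"
proof -
  define P where "P = max q p"
  have P: "q \<le> P" "x \<in> Mat P q"
    using assms by (auto simp: P_def intro: Mat_mono)
  then obtain k where k: "k \<in> Uni P" "arr_mult k x \<in> Psd q"
    using polar_decomposition by blast
  show ?thesis
  proof (rule that[OF k(2)])
    show "gram (arr_mult k x) = gram x" by (rule gram_Uni_mult[OF k(1) P(2)])
    then show "\<phi> (g_elt x) = \<phi> (g_elt (arr_mult k x))"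
      using P(2) Uni_mult_Mat[OF k(1) P(2)] by (intro phi_eq_if_gram_eq) auto
  qed
qed

lemma continuous_on_phi_g_elt:
  assumes "q \<le> p"
  shows "continuous_on (Mat p q) (\<lambda>x. \<phi> (g_elt x))"
  unfolding g_elt_def
  by (rule continuous_on_compose2[OF continuous_on_G[OF continuous assms]])
    (auto intro!: continuous_on_Pair continuous_on_id continuous_on_const simp: G_def one_in_Uni)

end

lemma Psd_Mat: "a \<in> Psd q \<Longrightarrow> a \<in> Mat q q"
  by (simp add: Psd_def Herm_def)

text \<open>
  The squared Hilbert-Schmidt distance of the Gram matrices.
\<close>
definition gram_dist2 :: "nat \<Rightarrow> 'f::star_div_algebra arr \<Rightarrow> 'f arr \<Rightarrow> real" where
  "gram_dist2 q x y = (\<Sum>i<q. \<Sum>j<q. (norm (gram x i j - gram y i j))\<^sup>2)"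

lemma gram_dist2_nonneg: "0 \<le> gram_dist2 q x y"
  by (simp add: gram_dist2_def sum_nonneg)

lemma gram_dist2_eq_0:
  assumes "x \<in> Mat p q" "y \<in> Mat p' q" "gram_dist2 q x y = 0"
  shows "gram x = gram y"
proof (intro ext)
  fix i j
  show "gram x i j = gram y i j"
  proof (cases "i < q \<and> j < q")
    case True
    have "\<forall>i\<in>{..<q}. (\<Sum>j<q. (norm (gram x i j - gram y i j))\<^sup>2) = 0"
      using assms(3) unfolding gram_dist2_def
      by (subst (asm) sum_nonneg_eq_0_iff) (auto intro: sum_nonneg)
    then have "(\<Sum>j<q. (norm (gram x i j - gram y i j))\<^sup>2) = 0" using True by blast
    then have "\<forall>j\<in>{..<q}. (norm (gram x i j - gram y i j))\<^sup>2 = 0"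
      by (subst (asm) sum_nonneg_eq_0_iff) auto
    then show ?thesis using True by simp
  next
    case False
    then show ?thesis
      using gram_in_Herm[OF assms(1)] gram_in_Herm[OF assms(2)] by (auto simp: Herm_def Mat_def)
  qed
qed

lemma closed_Mat: "closed (Mat p q :: 'f::star_div_algebra arr set)"
  unfolding Mat_def
  by (intro closed_Collect_all closed_Collect_imp open_Collect_const closed_Collect_eq
      continuous_on_arr_entry continuous_on_const)

context biinvariant_function
begin

text \<open>
  Continuity with respect to the Gram matrix, uniform on matrices with bounded entries, with a quadratic bound
  that can be integrated directly. On the compact set of matrices \<open>a\<close> where the difference is at least \<open>\<epsilon>\<close>, the
  Gram distance to \<open>z\<close> does not vanish, hence is at least some \<open>\<delta> > 0\<close>; then \<open>C = M / \<delta>\<close> works, with \<open>M\<close>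
  the maximal difference.
\<close>
lemma phi_modulus:
  assumes z: "z \<in> Mat q q" and "0 < \<epsilon>"
  shows "\<exists>C\<ge>0. \<forall>a\<in>Mat q q. (\<forall>i j. norm (a i j) \<le> R) \<longrightarrow>
     norm (\<phi> (g_elt a) - \<phi> (g_elt z)) \<le> \<epsilon> + C * gram_dist2 q a z"
proof -
  define S where "S = {a::'f arr. \<forall>i j. norm (a i j) \<le> R} \<inter> Mat q q"
  define f where "f = (\<lambda>a. norm (\<phi> (g_elt a) - \<phi> (g_elt z)))"
  define T where "T = S \<inter> (f -` {\<epsilon>..} \<inter> Mat q q)"
  have S: "compact S"
    unfolding S_def by (intro compact_Int_closed compact_bounded_arrays closed_Mat)
  have f: "continuous_on (Mat q q) f"
    unfolding f_def by (intro continuous_on_norm continuous_on_diff continuous_on_const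
        continuous_on_phi_g_elt) simp
  then have fS: "continuous_on S f" by (rule continuous_on_subset) (auto simp: S_def)
  have "closed (f -` {\<epsilon>..} \<inter> Mat q q)"
    using f by (simp add: continuous_on_closed_vimage[OF closed_Mat])
  then have T: "compact T" unfolding T_def by (rule compact_Int_closed[OF S])
  have "continuous_on T (\<lambda>a. \<Sum>i<q. \<Sum>j<q. (norm ((\<Sum>l<q. star (a l i) * a l j) - gram z i j))\<^sup>2)"
    by (intro continuous_on_sum continuous_on_power continuous_on_norm continuous_on_diff
        continuous_on_mult continuous_on_star continuous_on_arr_entry continuous_on_const)
  then have g: "continuous_on T (\<lambda>a. gram_dist2 q a z)"
    by (rule continuous_on_eq) (auto simp: gram_dist2_def T_def gram_eq_sum)
  show ?thesis
  proof (cases "T = {}")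
    case True
    then have "f a \<le> \<epsilon>" if "a \<in> S" for a
      using that by (force simp: T_def S_def)
    then show ?thesis by (intro exI[of _ 0]) (auto simp: S_def f_def)
  next
    case False
    obtain a0 where a0: "a0 \<in> T" "\<And>a. a \<in> T \<Longrightarrow> gram_dist2 q a0 z \<le> gram_dist2 q a z"
      using continuous_attains_inf[OF T False g] by blast
    obtain a1 where a1: "a1 \<in> S" "\<And>a. a \<in> S \<Longrightarrow> f a \<le> f a1"
      using continuous_attains_sup[OF S _ fS] a0(1) by (auto simp: T_def)
    define \<delta> where "\<delta> = gram_dist2 q a0 z"
    have "\<delta> \<noteq> 0"
    proof
      assume "\<delta> = 0"
      moreover have "a0 \<in> Mat q q" using a0(1) by (simp add: T_def)
      ultimately have "\<phi> (g_elt a0) = \<phi> (g_elt z)"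
        using gram_dist2_eq_0 phi_eq_if_gram_eq z by (metis \<delta>_def)
      then show False using a0(1) \<open>0 < \<epsilon>\<close> by (simp add: T_def f_def)
    qed
    then have \<delta>: "0 < \<delta>" using gram_dist2_nonneg[of q a0 z] by (simp add: \<delta>_def)
    have f_nonneg: "0 \<le> f a" for a by (simp add: f_def)
    have "f a \<le> \<epsilon> + f a1 / \<delta> * gram_dist2 q a z" if "a \<in> S" for a
    proof (cases "a \<in> T")
      case True
      have "f a \<le> f a1 / \<delta> * \<delta>" using a1(2)[OF that] \<delta> by simp
      also have "\<dots> \<le> f a1 / \<delta> * gram_dist2 q a z"
        using a0(2)[OF True] \<delta> f_nonneg by (intro mult_left_mono) (auto simp: \<delta>_def)
      finally show ?thesis using \<open>0 < \<epsilon>\<close> by simp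
    next
      case False
      then have "f a \<le> \<epsilon>" using that by (auto simp: T_def S_def)
      moreover have "0 \<le> f a1 / \<delta> * gram_dist2 q a z"
        using \<delta> f_nonneg gram_dist2_nonneg by (intro mult_nonneg_nonneg divide_nonneg_pos)
      ultimately show ?thesis by simp
    qed
    then show ?thesis
      using \<delta> f_nonneg by (intro exI[of _ "f a1 / \<delta>"]) (auto simp: S_def f_def)
  qed
qed

end

section \<open>The limit of the integrals over the unitary groups\<close>

text \<open>
  Only the entries of \<open>k\<close> in the upper left \<open>n \<times> n\<close>-block meet nonzero entries of \<open>w\<close> and \<open>y\<close>.
\<close>
lemma norm_gram_cross_le:
  fixes w y :: "'f::star_div_algebra arr"
  assumes w: "w \<in> Mat n q" and y: "y \<in> Mat n q" and k: "k \<in> Uni p" and "n \<le> p"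
    and W: "\<And>i j. norm (w i j) \<le> W" "\<And>i j. norm (y i j) \<le> W"
  shows "norm (gram (arr_add w (arr_mult k y)) i j - (gram w i j + gram y i j)) \<le>
    2 * W\<^sup>2 * (\<Sum>l<n. \<Sum>m<n. norm (k l m))"
proof -
  define Y where "Y = arr_mult k y"
  have wp: "w \<in> Mat p q" and yp: "y \<in> Mat p q" using w y \<open>n \<le> p\<close> by (auto intro: Mat_mono)
  have Yp: "Y \<in> Mat p q" unfolding Y_def by (rule Uni_mult_Mat[OF k yp])
  have sp: "arr_add w Y \<in> Mat p q" using wp Yp by (auto simp: Mat_def arr_add_def)
  define X where "X = (\<lambda>i j. \<Sum>l<p. star (w l i) * Y l j)"
  have "gram (arr_add w Y) i j = gram w i j + gram Y i j + (X i j + star (X j i))"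
    unfolding gram_eq_sum[OF sp] gram_eq_sum[OF wp] gram_eq_sum[OF Yp] X_def
    by (simp add: arr_add_def star_add star_sum star_mult star_star distrib_left distrib_right
        sum.distrib)
  then have "gram (arr_add w Y) i j - (gram w i j + gram y i j) = X i j + star (X j i)"
    using gram_Uni_mult[OF k yp] by (simp add: Y_def)
  moreover have X: "norm (X i j) \<le> W\<^sup>2 * (\<Sum>l<n. \<Sum>m<n. norm (k l m))" for i j
  proof -
    have "X i j = (\<Sum>l<n. star (w l i) * Y l j)"
      unfolding X_def using w \<open>n \<le> p\<close>
      by (intro sum.mono_neutral_right) (auto simp: Mat_def)
    also have "\<dots> = (\<Sum>l<n. \<Sum>m<n. star (w l i) * (k l m * y m j))"
    proof (intro sum.cong refl)
      fix l assume "l \<in> {..<n}"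
      then have "Y l j = (\<Sum>m<p. k l m * y m j)"
        unfolding Y_def using \<open>n \<le> p\<close> by (intro Uni_mult_eq_sum[OF k]) auto
      also have "\<dots> = (\<Sum>m<n. k l m * y m j)"
        using y \<open>n \<le> p\<close> by (intro sum.mono_neutral_right) (auto simp: Mat_def)
      finally show "star (w l i) * Y l j = (\<Sum>m<n. star (w l i) * (k l m * y m j))"
        by (simp add: sum_distrib_left)
    qed
    also have "norm \<dots> \<le> (\<Sum>l<n. \<Sum>m<n. norm (star (w l i) * (k l m * y m j)))"
      by (rule order_trans[OF norm_sum]) (intro sum_mono norm_sum)
    also have "\<dots> \<le> (\<Sum>l<n. \<Sum>m<n. W\<^sup>2 * norm (k l m))"
    proof (intro sum_mono)
      fix l m
      have "norm (w l i) * norm (y m j) \<le> W * W"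
        using W norm_ge_zero order_trans by (intro mult_mono) blast+
      then have "norm (w l i) * norm (y m j) * norm (k l m) \<le> W * W * norm (k l m)"
        by (intro mult_right_mono) auto
      then show "norm (star (w l i) * (k l m * y m j)) \<le> W\<^sup>2 * norm (k l m)"
        by (simp add: norm_mult power2_eq_square mult_ac)
    qed
    finally show ?thesis by (simp add: sum_distrib_left)
  qed
  ultimately have "norm (gram (arr_add w Y) i j - (gram w i j + gram y i j)) \<le>
      norm (X i j) + norm (X j i)"
    by (metis norm_triangle_ineq norm_star)
  also have "\<dots> \<le> 2 * W\<^sup>2 * (\<Sum>l<n. \<Sum>m<n. norm (k l m))"
    using X[of i j] X[of j i] by simp
  finally show ?thesis by (simp add: Y_def)
qed

lemma Mat_bounded:
  assumes "x \<in> Mat n q"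
  obtains B where "0 \<le> B" "\<And>i j. norm (x i j :: 'f::star_div_algebra) \<le> B"
proof
  let ?B = "\<Sum>i<n. \<Sum>j<q. norm (x i j)"
  show "0 \<le> ?B" by (intro sum_nonneg) auto
  fix i j
  show "norm (x i j) \<le> ?B"
  proof (cases "i < n \<and> j < q")
    case True
    then have "norm (x i j) \<le> (\<Sum>j<q. norm (x i j))" by (intro member_le_sum) auto
    also have "\<dots> \<le> ?B" using True by (intro member_le_sum) (auto intro: sum_nonneg)
    finally show ?thesis .
  next
    case False
    then have "x i j = 0" using assms by (auto simp: Mat_def)
    then show ?thesis using \<open>0 \<le> ?B\<close> by simp
  qed
qed

lemma norm_entry_power2_le_gram:
  assumes "a \<in> Mat p q"
  shows "(norm (a i j))\<^sup>2 \<le> norm (gram a j j)"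
proof (cases "i < p")
  case True
  have "(norm (a i j))\<^sup>2 \<le> (\<Sum>i<p. (norm (a i j))\<^sup>2)"
    using True by (intro member_le_sum) auto
  also have "\<dots> = norm (gram a j j)"
    unfolding gram_eq_sum[OF assms] star_mult_self
    by (simp add: scaleR_sum_left[symmetric] sum_nonneg)
  finally show ?thesis .
next
  case False
  then show ?thesis using assms by (simp add: Mat_def)
qed

context biinvariant_function
begin

text \<open>
  Left translation by the inverse of \<open>u\<close> turns \<open>x + u k y\<close> into \<open>u\<^sup>* x + k y\<close>.
\<close>
lemma phi_gmult:
  assumes "q \<le> n" "n \<le> p" and x: "x \<in> Mat n q" and y: "y \<in> Mat n q"
    and u: "u \<in> Uni n" and v: "v \<in> Uni n" and k: "k \<in> K p"
  shows "\<phi> (gmult (gmult (x, u) k) (y, v)) =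
    \<phi> (g_elt (arr_add (arr_mult (arr_adj u) x) (arr_mult (snd k) y)))"
proof -
  have u': "u \<in> Uni p" and v': "v \<in> Uni p" using u v \<open>n \<le> p\<close> by (auto intro: Uni_mono)
  have x': "x \<in> Mat p q" and y': "y \<in> Mat p q" using x y \<open>n \<le> p\<close> by (auto intro: Mat_mono)
  note k' = K_snd[OF k]
  have Y: "arr_mult u (arr_mult (snd k) y) \<in> Mat p q"
    using u' k' y' by (intro Uni_mult_Mat)
  have "gmult (gmult (x, u) k) (y, v) =
    (arr_add x (arr_mult u (arr_mult (snd k) y)), arr_mult (arr_mult u (snd k)) v)"
    by (simp add: gmult_def K_fst[OF k] Uni_mult_assoc[OF u' k'])
  also have "\<phi> \<dots> = \<phi> (g_elt (arr_mult (arr_adj u) (arr_add x (arr_mult u (arr_mult (snd k) y)))))"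
    using assms(1,2) x' Y u' v' k'
    by (intro phi_orbit[of p] Uni_mult Uni_adj) (auto simp: Mat_def arr_add_def)
  also have "arr_mult (arr_adj u) (arr_add x (arr_mult u (arr_mult (snd k) y))) =
      arr_add (arr_mult (arr_adj u) x) (arr_mult (snd k) y)"
    by (simp add: Uni_mult_add[OF Uni_adj[OF u']] Uni_mult_assoc[OF Uni_adj[OF u'] u', symmetric]
        Uni_inverse[OF u'])
  finally show ?thesis .
qed

lemma continuous_on_phi_gmult:
  assumes "q \<le> n" "n \<le> p" "x \<in> Mat n q" and y: "y \<in> Mat n q" and u: "u \<in> Uni n" and "v \<in> Uni n"
  shows "continuous_on (K p) (\<lambda>k. \<phi> (gmult (gmult (x, u) k) (y, v)))"
proof -
  let ?w = "arr_mult (arr_adj u) x"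
  have w: "?w \<in> Mat p q" and y': "y \<in> Mat p q"
    using assms by (auto intro!: Mat_mono[OF _ \<open>n \<le> p\<close>] Uni_mult_Mat Uni_adj)
  have "continuous_on (K p) (\<lambda>k. arr_mult (snd k) y)"
    by (intro continuous_on_Uni_mult[where p=p] continuous_on_snd_K continuous_on_const) (simp add: K_snd)
  from continuous_on_add[OF continuous_on_const continuous_on_arrD[OF this]]
  have "continuous_on (K p) (\<lambda>k. arr_add ?w (arr_mult (snd k) y))"
    unfolding arr_add_def by (rule continuous_on_arrI)
  moreover have "arr_add ?w (arr_mult (snd k) y) \<in> Mat p q" if "k \<in> K p" for k
    using w Uni_mult_Mat[OF K_snd[OF that] y'] by (auto simp: Mat_def arr_add_def)
  ultimately have "continuous_on (K p) (\<lambda>k. \<phi> (g_elt (arr_add ?w (arr_mult (snd k) y))))"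
    using assms(1,2) by (intro continuous_on_compose2[OF continuous_on_phi_g_elt[of p]]) auto
  then show ?thesis
    by (rule continuous_on_eq) (simp add: phi_gmult[OF assms])
qed

text \<open>
  The matrix \<open>w + k y\<close> has \<open>p\<close> rows, and \<open>p\<close> is not bounded. Replacing it by a positive semidefinite
  \<open>q \<times> q\<close>-matrix with the same Gram matrix brings it into one compact set, where \<open>phi_modulus\<close> applies;
  this gives a constant that is independent of \<open>p\<close>.
\<close>
lemma phi_gmult_bound:
  assumes "q \<le> n" and x: "x \<in> Mat n q" and y: "y \<in> Mat n q" and z: "z \<in> Mat N q"
    and gram_z: "gram z = arr_add (gram x) (gram y)"
    and u: "u \<in> Uni n" and v: "v \<in> Uni n" and "0 < \<epsilon>"
  shows "\<exists>C\<ge>0. \<forall>p\<ge>n. \<forall>k\<in>K p. norm (\<phi> (gmult (gmult (x, u) k) (y, v)) - \<phi> (g_elt z)) \<le>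
     \<epsilon> + C * (\<Sum>l<n. \<Sum>m<n. (norm (snd k l m))\<^sup>2)"
proof -
  define w where "w = arr_mult (arr_adj u) x"
  have w: "w \<in> Mat n q" unfolding w_def by (intro Uni_mult_Mat Uni_adj x u)
  have gram_w: "gram w = gram x" unfolding w_def by (rule gram_Uni_mult[OF Uni_adj[OF u] x])
  obtain z' where z': "z' \<in> Psd q" "gram z' = gram z" "\<phi> (g_elt z) = \<phi> (g_elt z')"
    by (rule phi_polar[OF z])
  obtain W1 where W1: "0 \<le> W1" "\<And>i j. norm (w i j) \<le> W1" using Mat_bounded[OF w] by blast
  obtain W2 where W2: "0 \<le> W2" "\<And>i j. norm (y i j) \<le> W2" using Mat_bounded[OF y] by blast
  define W where "W = max W1 W2"
  have W: "norm (w i j) \<le> W" "norm (y i j) \<le> W" for i j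
    using W1(2)[of i j] W2(2)[of i j] by (auto simp: W_def)
  have "gram z \<in> Mat q q" using gram_in_Herm[OF z] by (simp add: Herm_def)
  from Mat_bounded[OF this] obtain B where B: "0 \<le> B" "\<And>i j. norm (gram z i j) \<le> B" by blast
  \<comment> \<open>A bound for the entries of a square matrix with the Gram matrix of \<open>w + k y\<close>, for all \<open>k\<close>: the
  squared norms of its columns are the diagonal entries of the Gram matrix, and \<open>|k\<^sub>l\<^sub>m| \<le> 1\<close>.\<close>
  define R where "R = sqrt (B + 2 * W\<^sup>2 * (real n * real n))"
  obtain C where C: "0 \<le> C" "\<And>a. a \<in> Mat q q \<Longrightarrow> (\<And>i j. norm (a i j) \<le> R) \<Longrightarrow>
     norm (\<phi> (g_elt a) - \<phi> (g_elt z)) \<le> \<epsilon> + C * gram_dist2 q a z"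
    using phi_modulus[OF Psd_Mat[OF z'(1)] \<open>0 < \<epsilon>\<close>, of R]
    unfolding z'(3)[symmetric] gram_dist2_def z'(2) by blast
  define D where "D = C * (real q * (real q * (4 * W^4 * (real n * real n))))"
  show ?thesis
  proof (intro exI[of _ D] conjI allI impI ballI)
    show "0 \<le> D" unfolding D_def using C(1) by (intro mult_nonneg_nonneg) auto
    fix p and k :: "'f elt" assume "n \<le> p" and k: "k \<in> K p"
    define S where "S = (\<Sum>l<n. \<Sum>m<n. norm (snd k l m))"
    define S2 where "S2 = (\<Sum>l<n. \<Sum>m<n. (norm (snd k l m))\<^sup>2)"
    define s where "s = arr_add w (arr_mult (snd k) y)"
    have yp: "y \<in> Mat p q" and wp: "w \<in> Mat p q" using y w \<open>n \<le> p\<close> by (auto intro: Mat_mono)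
    have s: "s \<in> Mat p q"
      using wp Uni_mult_Mat[OF K_snd[OF k] yp] by (auto simp: s_def Mat_def arr_add_def)
    obtain a where a: "a \<in> Psd q" "gram a = gram s" "\<phi> (g_elt s) = \<phi> (g_elt a)"
      by (rule phi_polar[OF s])
    have "S \<le> (\<Sum>l<n. \<Sum>m<n. 1)"
      unfolding S_def by (intro sum_mono norm_Uni_le_1[OF K_snd[OF k]])
    then have S_le: "S \<le> real n * real n" by simp
    have S_nonneg: "0 \<le> S" unfolding S_def by (intro sum_nonneg) auto
    have cross: "norm (gram a i j - gram z i j) \<le> 2 * W\<^sup>2 * S" for i j
      using norm_gram_cross_le[OF w y K_snd[OF k] \<open>n \<le> p\<close> W, of i j]
      by (simp add: a(2) s_def gram_w gram_z arr_add_def S_def)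
    have "norm (a i j) \<le> R" for i j
    proof -
      have "(norm (a i j))\<^sup>2 \<le> norm (gram a j j)"
        by (rule norm_entry_power2_le_gram[OF Psd_Mat[OF a(1)]])
      also have "\<dots> \<le> norm (gram z j j) + norm (gram a j j - gram z j j)"
        by (rule norm_triangle_sub)
      also have "\<dots> \<le> B + 2 * W\<^sup>2 * S"
        by (intro add_mono B(2) cross)
      also have "\<dots> \<le> B + 2 * W\<^sup>2 * (real n * real n)"
        by (intro add_left_mono mult_left_mono S_le) simp
      finally show ?thesis unfolding R_def by (rule real_le_rsqrt)
    qed
    then have "norm (\<phi> (g_elt a) - \<phi> (g_elt z)) \<le> \<epsilon> + C * gram_dist2 q a z"
      by (intro C(2) Psd_Mat[OF a(1)])
    also have "gram_dist2 q a z \<le> (\<Sum>i<q. \<Sum>j<q. (2 * W\<^sup>2 * S)\<^sup>2)"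
      unfolding gram_dist2_def by (intro sum_mono power_mono cross) auto
    also have "\<dots> = real q * (real q * (4 * W^4 * S\<^sup>2))"
      by (simp add: power_mult_distrib flip: power_mult)
    also have "S\<^sup>2 \<le> real n * real n * S2"
      using sum_squared_le_sum_of_squares[of "\<lambda>(l, m). norm (snd k l m)" "{..<n} \<times> {..<n}"]
      unfolding S_def S2_def sum.cartesian_product
      by (simp add: case_prod_unfold mult.commute)
    finally have "norm (\<phi> (g_elt a) - \<phi> (g_elt z)) \<le> \<epsilon> + D * S2"
      using C(1) by (simp add: D_def mult_left_mono mult.assoc)
    moreover have "\<phi> (gmult (gmult (x, u) k) (y, v)) = \<phi> (g_elt a)"
      using phi_gmult[OF \<open>q \<le> n\<close> \<open>n \<le> p\<close> x y u v k] a(3) by (simp add: s_def w_def)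
    ultimately show "norm (\<phi> (gmult (gmult (x, u) k) (y, v)) - \<phi> (g_elt z)) \<le>
        \<epsilon> + D * (\<Sum>l<n. \<Sum>m<n. (norm (snd k l m))\<^sup>2)"
      by (simp add: S2_def)
  qed
qed

lemma integral_phi_gmult_bound:
  assumes \<mu>: "normalized_haar p \<mu>" and "q \<le> n" "n \<le> p" "0 < p"
    and xyuv: "x \<in> Mat n q" "y \<in> Mat n q" "u \<in> Uni n" "v \<in> Uni n" and "0 \<le> C"
    and bound: "\<And>k. k \<in> K p \<Longrightarrow> norm (\<phi> (gmult (gmult (x, u) k) (y, v)) - c) \<le>
       \<epsilon> + C * (\<Sum>l<n. \<Sum>m<n. (norm (snd k l m))\<^sup>2)"
  shows "norm ((LINT k|\<mu>. \<phi> (gmult (gmult (x, u) k) (y, v))) - c) \<le> \<epsilon> + C * (real n * real n / real p)"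
proof -
  interpret prob_space \<mu> using \<mu> by (simp add: normalized_haar_def)
  let ?f = "\<lambda>k. \<phi> (gmult (gmult (x, u) k) (y, v))"
  let ?S2 = "\<lambda>k :: 'f elt. \<Sum>l<n. \<Sum>m<n. (norm (snd k l m))\<^sup>2"
  have moment: "integrable \<mu> (\<lambda>k. (norm (snd k l m))\<^sup>2)" "(LINT k|\<mu>. (norm (snd k l m))\<^sup>2) = 1 / p"
    if "l < n" "m < n" for l m
    using normalized_haar_second_moment[OF \<mu>, of l m] that \<open>n \<le> p\<close> by auto
  have int_S2: "integrable \<mu> ?S2"
    by (intro Bochner_Integration.integrable_sum moment) auto
  have "(LINT k|\<mu>. ?S2 k) = (\<Sum>l<n. \<Sum>m<n. LINT k|\<mu>. (norm (snd k l m))\<^sup>2)"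
  proof -
    have "(LINT k|\<mu>. ?S2 k) = (\<Sum>l<n. LINT k|\<mu>. (\<Sum>m<n. (norm (snd k l m))\<^sup>2))"
      using moment(1) by (intro Bochner_Integration.integral_sum Bochner_Integration.integrable_sum) auto
    also have "\<dots> = (\<Sum>l<n. \<Sum>m<n. LINT k|\<mu>. (norm (snd k l m))\<^sup>2)"
      using moment(1) by (intro sum.cong refl Bochner_Integration.integral_sum) auto
    finally show ?thesis .
  qed
  also have "\<dots> = real n * real n / real p" by (simp add: moment)
  finally have S2: "(LINT k|\<mu>. ?S2 k) = real n * real n / real p" .
  have cont: "continuous_on (K p) (\<lambda>k. ?f k - c)"
    by (intro continuous_on_diff continuous_on_const continuous_on_phi_gmult[of n] assms)
  have "norm (?f k - c) \<le> \<epsilon> + C * (real n * real n)" if k: "k \<in> K p" for k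
  proof -
    have "?S2 k \<le> (\<Sum>l<n. \<Sum>m<n. 1)"
      using norm_Uni_le_1[OF K_snd[OF k]] by (intro sum_mono power_le_one) auto
    then have "C * ?S2 k \<le> C * (real n * real n)"
      using \<open>0 \<le> C\<close> by (intro mult_left_mono) auto
    then show ?thesis using bound[OF k] by linarith
  qed
  then have int: "integrable \<mu> (\<lambda>k. ?f k - c)"
    by (rule normalized_haar_integrable[OF \<mu> cont])
  then have "integrable \<mu> (\<lambda>k. (?f k - c) + c)"
    by (rule Bochner_Integration.integrable_add) simp
  then have int_f: "integrable \<mu> ?f" by simp
  have "(LINT k|\<mu>. ?f k) - c = (LINT k|\<mu>. ?f k - c)"
    using int_f by (simp add: prob_space)
  also have "norm \<dots> \<le> (LINT k|\<mu>. norm (?f k - c))"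
    by (rule integral_norm_bound)
  also have "\<dots> \<le> (LINT k|\<mu>. \<epsilon> + C * ?S2 k)"
  proof (rule integral_mono[OF integrable_norm[OF int]])
    show "integrable \<mu> (\<lambda>k. \<epsilon> + C * ?S2 k)" using int_S2 by simp
  qed (use bound in \<open>simp add: normalized_haar_space[OF \<mu>]\<close>)
  also have "\<dots> = \<epsilon> + C * (real n * real n / real p)"
    using int_S2 S2 by (simp add: prob_space)
  finally show ?thesis .
qed

lemma integral_phi_gmult_tendsto:
  assumes \<mu>: "\<And>p. q \<le> p \<Longrightarrow> normalized_haar p (\<mu> p)" and "q \<le> n"
    and xyuv: "x \<in> Mat n q" "y \<in> Mat n q" "u \<in> Uni n" "v \<in> Uni n" and z: "z \<in> Mat N q"
    and gram_z: "gram z = arr_add (gram x) (gram y)"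
  shows "(\<lambda>p. LINT k|\<mu> p. \<phi> (gmult (gmult (x, u) k) (y, v))) \<longlonglongrightarrow> \<phi> (g_elt z)"
proof (rule tendstoI)
  fix e :: real assume "0 < e"
  then obtain C where C: "0 \<le> C" "\<And>p k. n \<le> p \<Longrightarrow> k \<in> K p \<Longrightarrow>
      norm (\<phi> (gmult (gmult (x, u) k) (y, v)) - \<phi> (g_elt z)) \<le>
      e / 2 + C * (\<Sum>l<n. \<Sum>m<n. (norm (snd k l m))\<^sup>2)"
    using phi_gmult_bound[OF \<open>q \<le> n\<close> xyuv(1,2) z gram_z xyuv(3,4), of "e / 2"] by auto
  have "(\<lambda>p. C * (real n * real n / real p)) \<longlonglongrightarrow> C * 0"
    by (intro tendsto_mult tendsto_const lim_const_over_n)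
  then have "\<forall>\<^sub>F p in sequentially. C * (real n * real n / real p) < e / 2"
    using \<open>0 < e\<close> by (intro order_tendstoD(2)[where y="C * 0"]) auto
  moreover have "\<forall>\<^sub>F p in sequentially. max 1 n \<le> p" by (rule eventually_ge_at_top)
  ultimately show "\<forall>\<^sub>F p in sequentially.
      dist (LINT k|\<mu> p. \<phi> (gmult (gmult (x, u) k) (y, v))) (\<phi> (g_elt z)) < e"
  proof eventually_elim
    case (elim p)
    then have "norm ((LINT k|\<mu> p. \<phi> (gmult (gmult (x, u) k) (y, v))) - \<phi> (g_elt z)) \<le>
        e / 2 + C * (real n * real n / real p)"
      using \<open>q \<le> n\<close> by (intro integral_phi_gmult_bound[OF \<mu> \<open>q \<le> n\<close> _ _ xyuv C(1) C(2)]) auto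
    then show ?case unfolding dist_norm using elim(1) by linarith
  qed
qed

end

section \<open>Multiplicative functions on a ray\<close>

text \<open>
  With the primitive \<open>I\<close> of \<open>f\<close>, integrating the functional equation in two ways gives
  \<open>I t + f t * I a = I (t + a) = I a + f a * I t\<close>. If \<open>I a \<noteq> 0\<close> then \<open>f = 1 + c I\<close> for a constant \<open>c\<close>, so \<open>f\<close>
  solves \<open>f' = c f\<close>.
\<close>
lemma continuous_multiplicative_imp_exp:
  fixes f :: "real \<Rightarrow> complex"
  assumes cont: "continuous_on {0..} f" and "f 0 = 1"
    and mult: "\<And>s t. 0 \<le> s \<Longrightarrow> 0 \<le> t \<Longrightarrow> f (s + t) = f s * f t"
  shows "\<exists>c. \<forall>t\<ge>0. f t = exp (t *\<^sub>R c)"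
proof -
  define I where "I = (\<lambda>t. integral {0..t} f)"
  have cont': "continuous_on {0..t} f" for t
    by (rule continuous_on_subset[OF cont]) auto
  have int: "f integrable_on {0..t}" for t by (rule integrable_continuous_real[OF cont'])
  have I_add: "I (s + t) = I s + f s * I t" if "0 \<le> s" "0 \<le> t" for s t
  proof -
    have "integral {s..s + t} f = integral {0..t} (f \<circ> (+) s)"
      using integral_shift_Icc_real[of 0 t f s] by (simp add: add.commute)
    also have "\<dots> = integral {0..t} (\<lambda>u. f s * f u)"
      using that mult by (intro Henstock_Kurzweil_Integration.integral_cong) auto
    finally have "integral {s..s + t} f = f s * I t" by (simp add: I_def)
    moreover have "integral {0..s} f + integral {s..s + t} f = integral {0..s + t} f"
      using that by (intro Henstock_Kurzweil_Integration.integral_combine int) auto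
    ultimately show ?thesis by (simp add: I_def)
  qed
  obtain a where a: "0 < a" "I a \<noteq> 0"
  proof -
    have "continuous (at 0 within {0..}) f" using cont by (simp add: continuous_on_eq_continuous_within)
    then have "\<exists>d>0. \<forall>t\<in>{0..}. dist t 0 < d \<longrightarrow> dist (f t) (f 0) < 1 / 2"
      unfolding continuous_within_eps_delta by (rule spec[of _ "1 / 2", THEN mp]) simp
    then obtain d where "0 < d" and d': "\<forall>t\<in>{0..}. dist t 0 < d \<longrightarrow> dist (f t) (f 0) < 1 / 2"
      by blast
    have d: "0 < d" "\<And>t. 0 \<le> t \<Longrightarrow> t < d \<Longrightarrow> dist (f t) (f 0) < 1 / 2"
      using \<open>0 < d\<close> d' by (simp_all add: dist_norm)
    define a where "a = d / 2"
    have "0 < a" using d(1) by (simp add: a_def)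
    \<comment> \<open>Close to \<open>0\<close> the values of \<open>f\<close> are close to \<open>f 0 = 1\<close>, so the primitive does not vanish.\<close>
    have "norm (integral (cbox 0 a) (\<lambda>t. f t - 1)) \<le> 1 / 2 * measure lborel (cbox 0 a)"
    proof (rule integrable_bound)
      show "(\<lambda>t. f t - 1) integrable_on cbox 0 a" using int by (intro integrable_diff) auto
      show "norm (f t - 1) \<le> 1 / 2" if "t \<in> cbox 0 a" for t
        using d(2)[of t] that d(1) \<open>f 0 = 1\<close> by (simp add: a_def dist_norm)
    qed simp
    moreover have "integral (cbox 0 a) (\<lambda>t. f t - 1) = I a - of_real a"
      using \<open>0 < a\<close> Henstock_Kurzweil_Integration.integral_diff[OF int[of a] integrable_const_ivl[of 1 0 a]]
      by (simp add: I_def scaleR_conv_of_real)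
    ultimately have "norm (I a - of_real a) \<le> a / 2" using \<open>0 < a\<close> by simp
    then have "I a \<noteq> 0" using \<open>0 < a\<close> by auto
    with \<open>0 < a\<close> show ?thesis by (rule that)
  qed
  define c where "c = (f a - 1) / I a"
  have f_I: "f t = 1 + c * I t" if "0 \<le> t" for t
  proof -
    have "I t + f t * I a = I a + f a * I t"
      using I_add[of t a] I_add[of a t] that a(1) by (simp add: add.commute)
    then show ?thesis using a(2) by (simp add: c_def field_simps)
  qed
  have "f t = exp (t *\<^sub>R c)" if "0 \<le> t" for t
  proof -
    define h where "h = (\<lambda>u. (1 + c * I u) * exp (u *\<^sub>R (- c)))"
    have "(h has_vector_derivative 0) (at u within {0..t})" if u: "u \<in> {0..t}" for u
    proof -
      have "(I has_vector_derivative f u) (at u within {0..t})"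
        unfolding I_def by (rule integral_has_vector_derivative[OF cont' u])
      then have "((\<lambda>u. 1 + c * I u) has_vector_derivative 0 + c * f u) (at u within {0..t})"
        by (intro has_vector_derivative_add has_vector_derivative_const has_vector_derivative_mult_right)
      from has_vector_derivative_mult[OF this exp_scaleR_has_vector_derivative_right[of "- c" u]]
      have "(h has_vector_derivative
          (1 + c * I u) * (exp (u *\<^sub>R (- c)) * - c) + (0 + c * f u) * exp (u *\<^sub>R (- c))) (at u within {0..t})"
        by (simp only: h_def)
      then show ?thesis using f_I[of u] u by (simp add: algebra_simps)
    qed
    then obtain C where "\<And>u. u \<in> {0..t} \<Longrightarrow> h u = C"
      using has_vector_derivative_zero_constant[of "{0..t}" h] by auto
    then have "h t = h 0" using that by simp
    then have "f t * exp (- (t *\<^sub>R c)) = 1" using f_I[OF that] by (simp add: h_def I_def)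
    then show ?thesis by (simp add: exp_minus field_simps)
  qed
  then show ?thesis by blast
qed

text \<open>
  Otherwise the exponential of a complex number of norm \<open>1\<close> would be \<open>1\<close>, but the nonzero periods have norm at
  least \<open>2 \<pi>\<close>.
\<close>
lemma exp_scaleR_inj:
  assumes "\<And>t. 0 \<le> t \<Longrightarrow> exp (t *\<^sub>R c) = exp (t *\<^sub>R (c' :: complex))"
  shows "c = c'"
proof (rule ccontr)
  assume "c \<noteq> c'"
  define d where "d = c - c'"
  have d: "d \<noteq> 0" using \<open>c \<noteq> c'\<close> by (simp add: d_def)
  define z where "z = (1 / norm d) *\<^sub>R d"
  have "exp z = 1"
    using assms[of "1 / norm d"] by (simp add: z_def d_def exp_diff scaleR_diff_right)
  then obtain n :: int where n: "Re z = 0" "Im z = of_int (2 * n) * pi"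
    unfolding exp_eq_1 by blast
  have "norm z = 1" using d by (simp add: z_def)
  then have "\<bar>of_int (2 * n) * pi\<bar> = 1"
    using n by (simp add: cmod_eq_Im)
  then have n0: "n \<noteq> 0" and "\<bar>of_int n :: real\<bar> * (2 * pi) = 1" by (auto simp: abs_mult)
  moreover have "1 \<le> \<bar>of_int n :: real\<bar>" using n0 by linarith
  then have "1 * (2 * pi) \<le> \<bar>of_int n :: real\<bar> * (2 * pi)" by (intro mult_right_mono) auto
  ultimately show False using pi_gt3 by simp
qed

section \<open>Linear functionals on Hermitian matrices\<close>

definition arr_scale :: "real \<Rightarrow> 'f::star_div_algebra arr \<Rightarrow> 'f arr" where
  "arr_scale t x = (\<lambda>i j. t *\<^sub>R x i j)"

lemma herm_inner_eq_sum:
  assumes "r \<in> Mat q q"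
  shows "herm_inner q r b = (\<Sum>i<q. \<Sum>k<q. repart (r i k * b k i))"
  unfolding herm_inner_def repart_sum
  by (intro sum.cong refl)
    (simp add: arr_mult_eq_sum[OF lower_beyond_Mat[OF assms order_refl] order_refl] repart_sum)

lemma Herm_Mat: "r \<in> Herm q \<Longrightarrow> r \<in> Mat q q"
  by (simp add: Herm_def)

lemma Herm_star: "r \<in> Herm q \<Longrightarrow> star (r j i) = r i j"
  unfolding Herm_def arr_adj_def by (auto dest: fun_cong)

lemma HermI:
  assumes "\<And>i j. star (r j i) = r i j" "\<And>i j. q \<le> i \<Longrightarrow> r i j = 0" 
  shows "r \<in> Herm q"
proof -
  have "r i j = 0" if "q \<le> j" for i j using assms(1)[of j i] assms(2)[OF that, of i] by simp
  then show ?thesis using assms by (auto simp: Herm_def Mat_def arr_adj_def)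
qed

lemma Herm_add: "r \<in> Herm q \<Longrightarrow> s \<in> Herm q \<Longrightarrow> arr_add r s \<in> Herm q"
  by (rule HermI) (auto simp: arr_add_def star_add Herm_star Herm_def Mat_def)

lemma Herm_scale: "r \<in> Herm q \<Longrightarrow> arr_scale t r \<in> Herm q"
  by (rule HermI) (auto simp: arr_scale_def star_scaleR Herm_star Herm_def Mat_def)

text \<open>
  The Hermitian part of the matrix with the single entry \<open>w\<close> at \<open>(i, j)\<close>.
\<close>
definition herm_unit :: "nat \<Rightarrow> nat \<Rightarrow> 'f \<Rightarrow> 'f::star_div_algebra arr" where
  "herm_unit i j w = (\<lambda>a b. (1 / 2) *\<^sub>R ((if a = i \<and> b = j then w else 0) + (if a = j \<and> b = i then star w else 0)))"

lemma herm_unit_in_Herm: "i < q \<Longrightarrow> j < q \<Longrightarrow> herm_unit i j w \<in> Herm q"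
  by (rule HermI)
    (simp_all add: herm_unit_def star_scaleR star_add if_distrib[of star] star_star
      add.commute conj_commute cong: if_cong)

text \<open>
  The representation of linear functionals by a scalar product. On Hermitian matrices the scalar product is
  \<open>\<Sum>\<^sub>i\<^sub>j inner (r i j) (b i j)\<close>, so \<open>b i j\<close> represents \<open>w \<mapsto> L (herm_unit i j w)\<close>; \<open>b\<close> is Hermitian since
  \<open>herm_unit j i (star w) = herm_unit i j w\<close>.
\<close>
lemma herm_functional_representation:
  fixes L :: "'f::star_div_algebra arr \<Rightarrow> real"
  assumes add: "\<And>r s. r \<in> Herm q \<Longrightarrow> s \<in> Herm q \<Longrightarrow> L (arr_add r s) = L r + L s"
    and scale: "\<And>r t. r \<in> Herm q \<Longrightarrow> L (arr_scale t r) = t * L r"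
  shows "\<exists>b\<in>Herm q. \<forall>r\<in>Herm q. L r = herm_inner q r b"
proof -
  define b :: "'f arr" where "b = (\<lambda>i j. if i < q \<and> j < q then \<Sum>w\<in>Basis. L (herm_unit i j w) *\<^sub>R w else 0)"
  have inner_b: "inner w (b i j) = L (herm_unit i j w)" if ij: "i < q" "j < q" for i j w
  proof -
    have if_add: "(if P then v + w else 0) = (if P then v else 0) + (if P then w else 0)"
      and if_scaleR: "(if P then t *\<^sub>R v else 0) = t *\<^sub>R (if P then v else 0)"
      for P and v w :: 'f and t by simp_all
    have lin: "linear (\<lambda>w. L (herm_unit i j w))"
    proof (rule linearI)
      fix v w :: 'f and t :: real
      have "herm_unit i j (v + w) = arr_add (herm_unit i j v) (herm_unit i j w)"
        unfolding herm_unit_def arr_add_def scaleR_add_right[symmetric]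
        by (intro ext arg_cong[where f="scaleR (1 / 2)"]) (simp only: star_add if_add ac_simps)
      then show "L (herm_unit i j (v + w)) = L (herm_unit i j v) + L (herm_unit i j w)"
        by (simp add: add herm_unit_in_Herm ij)
      have "herm_unit i j (t *\<^sub>R w) = arr_scale t (herm_unit i j w)"
        unfolding herm_unit_def arr_scale_def scaleR_left_commute[of t]
        by (intro ext arg_cong[where f="scaleR (1 / 2)"]) (simp only: star_scaleR if_scaleR scaleR_add_right)
      then show "L (herm_unit i j (t *\<^sub>R w)) = t *\<^sub>R L (herm_unit i j w)"
        by (simp add: scale herm_unit_in_Herm ij)
    qed
    have "L (herm_unit i j w) = L (herm_unit i j (\<Sum>v\<in>Basis. inner w v *\<^sub>R v))"
      by (simp add: euclidean_representation)
    also have "\<dots> = (\<Sum>v\<in>Basis. inner w v * L (herm_unit i j v))"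
      using linear_sum[OF lin, of "\<lambda>v. inner w v *\<^sub>R v" Basis] linear_scale[OF lin] by simp
    also have "\<dots> = inner w (b i j)"
      using ij by (simp add: b_def inner_sum_right mult.commute)
    finally show ?thesis ..
  qed
  have b: "b \<in> Herm q"
  proof (rule HermI)
    fix i j
    show "star (b j i) = b i j"
    proof (cases "i < q \<and> j < q")
      case True
      have "inner w (star (b j i)) = inner w (b i j)" for w
      proof -
        have "inner w (star (b j i)) = inner (star w) (b j i)"
          using inner_star_star[of w "star (b j i)"] by (simp add: star_star)
        also have "\<dots> = L (herm_unit j i (star w))" using True by (simp add: inner_b)
        also have "herm_unit j i (star w) = herm_unit i j w"
          by (intro ext) (simp only: herm_unit_def star_star add.commute conj_commute)
        finally show ?thesis using True by (simp add: inner_b)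
      qed
      then show ?thesis using vector_eq_ldot by blast
    qed (auto simp: b_def)
  qed (auto simp: b_def)
  have L0: "L arr_zero = 0"
    using scale[of arr_zero 0] by (simp add: arr_scale_def arr_zero_def HermI)
  have L_sum: "L (\<lambda>a c. \<Sum>i\<in>A. X i a c) = (\<Sum>i\<in>A. L (X i)) \<and> (\<lambda>a c. \<Sum>i\<in>A. X i a c) \<in> Herm q"
    if "finite A" "\<And>i. i \<in> A \<Longrightarrow> X i \<in> Herm q" for A :: "(nat \<times> nat) set" and X
    using that
  proof (induction A rule: finite_induct)
    case empty
    then show ?case using L0 by (auto simp: arr_zero_def intro: HermI)
  next
    case (insert i A)
    have "(\<lambda>a c. \<Sum>i\<in>insert i A. X i a c) = arr_add (X i) (\<lambda>a c. \<Sum>i\<in>A. X i a c)"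
      using insert by (auto simp: arr_add_def)
    then show ?case using insert by (simp add: add Herm_add)
  qed
  have "L r = herm_inner q r b" if r: "r \<in> Herm q" for r
  proof -
    have sum_if: "(\<Sum>j<q. if P then f j else 0) = (if P then \<Sum>j<q. f j else 0)"
      for P and f :: "nat \<Rightarrow> 'f" by simp
    let ?A = "{..<q} \<times> {..<q}"
    let ?X = "\<lambda>(i, j). herm_unit i j (r i j)"
    have "r a c = (\<Sum>p\<in>?A. ?X p a c)" for a c
    proof (cases "a < q \<and> c < q")
      case True
      have "(\<Sum>p\<in>?A. ?X p a c) = (1 / 2) *\<^sub>R (\<Sum>i<q. \<Sum>j<q.
          (if a = i then if c = j then r i j else 0 else 0) + (if c = i then if a = j then star (r i j) else 0 else 0))"
        unfolding scaleR_sum_right sum.cartesian_product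
        by (intro sum.cong) (auto simp: herm_unit_def)
      also have "\<dots> = (1 / 2) *\<^sub>R (r a c + star (r c a))"
        using True by (simp add: sum.distrib sum_if)
      also have "\<dots> = r a c" by (simp add: Herm_star[OF r] scaleR_2[symmetric])
      finally show ?thesis ..
    next
      case False
      have "(\<Sum>p\<in>?A. ?X p a c) = 0"
      proof (rule sum.neutral, rule ballI)
        fix p assume "p \<in> ?A"
        then have "?X p \<in> Mat q q" by (auto intro!: Herm_Mat herm_unit_in_Herm)
        then show "?X p a c = 0" using False by (auto simp: Mat_def)
      qed
      then show ?thesis using Herm_Mat[OF r] False by (auto simp: Mat_def)
    qed
    then have "r = (\<lambda>a c. \<Sum>p\<in>?A. ?X p a c)" by blast
    then have "L r = (\<Sum>p\<in>?A. L (?X p))"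
      using L_sum[of ?A ?X] herm_unit_in_Herm by auto
    also have "\<dots> = (\<Sum>(i, j)\<in>?A. repart (r i j * b j i))"
    proof (rule sum.cong[OF refl])
      fix p assume "p \<in> ?A"
      then obtain i j where p: "p = (i, j)" "i < q" "j < q" by auto
      then have "L (herm_unit i j (r i j)) = inner (r i j) (b i j)" by (simp add: inner_b)
      also have "\<dots> = inner (b i j) (r i j)" by (rule inner_commute)
      also have "\<dots> = repart (b j i * r i j)" unfolding inner_eq_repart Herm_star[OF b] ..
      also have "\<dots> = repart (r i j * b j i)" by (rule repart_mult_commute)
      finally show "L (?X p) = (case p of (i, j) \<Rightarrow> repart (r i j * b j i))" by (simp add: p)
    qed
    also have "\<dots> = herm_inner q r b"
      by (simp add: herm_inner_eq_sum[OF Herm_Mat[OF r]] sum.cartesian_product)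
    finally show ?thesis .
  qed
  with b show ?thesis by blast
qed

text \<open>
  All numbers of rows are admitted, which makes closure under addition obvious by stacking matrices. By the polar
  decomposition this is the set of squares of elements of \<open>\<Pi>\<^sub>q\<close>.
\<close>
definition gram_cone :: "nat \<Rightarrow> 'f::star_div_algebra arr set" where
  "gram_cone q = {gram x | x p. x \<in> Mat p q}"

lemma gram_cone_Herm: "r \<in> gram_cone q \<Longrightarrow> r \<in> Herm q"
  by (auto simp: gram_cone_def gram_in_Herm)

lemma gram_scale:
  assumes "x \<in> Mat p q"
  shows "gram (arr_scale t x) = arr_scale (t\<^sup>2) (gram x)"
proof -
  have "arr_scale t x \<in> Mat p q" using assms by (simp add: Mat_def arr_scale_def)
  then show ?thesis
    using assms by (auto simp: gram_eq_sum arr_scale_def star_scaleR scaleR_sum_right power2_eq_square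
        fun_eq_iff)
qed

lemma Mat_scale: "x \<in> Mat p q \<Longrightarrow> arr_scale t x \<in> Mat p q"
  by (simp add: Mat_def arr_scale_def)

lemma gram_cone_scale: "r \<in> gram_cone q \<Longrightarrow> 0 \<le> t \<Longrightarrow> arr_scale t r \<in> gram_cone q"
  unfolding gram_cone_def using gram_scale[of _ _ q "sqrt t"] Mat_scale[of _ _ q "sqrt t"]
  by (smt (verit) mem_Collect_eq real_sqrt_pow2)

definition stack :: "nat \<Rightarrow> 'f arr \<Rightarrow> 'f arr \<Rightarrow> 'f::star_div_algebra arr" where
  "stack n x y = (\<lambda>i j. if i < n then x i j else y (i - n) j)"

lemma stack_in_Mat: "x \<in> Mat n q \<Longrightarrow> y \<in> Mat m q \<Longrightarrow> stack n x y \<in> Mat (n + m) q"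
  by (auto simp: Mat_def stack_def)

lemma sum_lessThan_add: "(\<Sum>i<n + m. f i) = (\<Sum>i<n. f i) + (\<Sum>i<m. f (n + i :: nat) :: 'a::comm_monoid_add)"
  by (induction m) (auto simp: add.assoc)

lemma gram_stack:
  assumes "x \<in> Mat n q" "y \<in> Mat m q"
  shows "gram (stack n x y) = arr_add (gram x) (gram y)"
  unfolding arr_add_def
  by (intro ext, unfold gram_eq_sum[OF stack_in_Mat[OF assms]] gram_eq_sum[OF assms(1)] gram_eq_sum[OF assms(2)])
     (simp add: sum_lessThan_add stack_def)

lemma gram_cone_add: "r \<in> gram_cone q \<Longrightarrow> s \<in> gram_cone q \<Longrightarrow> arr_add r s \<in> gram_cone q"
proof -
  assume "r \<in> gram_cone q" "s \<in> gram_cone q"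
  then obtain x n y m where "r = gram x" "s = gram y" "x \<in> Mat n q" "y \<in> Mat m q"
    by (auto simp: gram_cone_def)
  then show ?thesis
    using gram_stack[of x n q y m] stack_in_Mat[of x n q y m] unfolding gram_cone_def by force
qed

text \<open>
  Polarization against the unit matrix: \<open>z = ((1 + z)/2)\<^sup>2 - ((1 - z)/2)\<^sup>2\<close>.
\<close>
lemma Herm_eq_gram_cone_diff:
  assumes z: "z \<in> Herm q"
  obtains r s where "r \<in> gram_cone q" "s \<in> gram_cone q" "r = arr_add z s"
proof -
  define e :: "'a arr" where "e = (\<lambda>i j. if i = j \<and> i < q then 1 else 0)"
  define x where "x = (\<lambda>i j. (1 / 2) *\<^sub>R (e i j + z i j))"
  define y where "y = (\<lambda>i j. (1 / 2) *\<^sub>R (e i j - z i j))"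
  have xM: "x \<in> Mat q q" and yM: "y \<in> Mat q q"
    using Herm_Mat[OF z] by (auto simp: x_def y_def e_def Mat_def)
  have "gram x i j = z i j + gram y i j" for i j
  proof (cases "i < q \<and> j < q")
    case True
    have "star (x l i) * x l j = (1 / 2) *\<^sub>R (star (e l i) * z l j + star (z l i) * e l j) + star (y l i) * y l j" for l
    proof -
      have "star (x l i) * x l j = (1 / 4) *\<^sub>R (star (e l i + z l i) * (e l j + z l j))"
        "star (y l i) * y l j = (1 / 4) *\<^sub>R (star (e l i - z l i) * (e l j - z l j))"
        by (simp_all add: x_def y_def star_scaleR)
      moreover have "star (e l i + z l i) * (e l j + z l j) =
        2 *\<^sub>R (star (e l i) * z l j + star (z l i) * e l j) + star (e l i - z l i) * (e l j - z l j)"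
        by (simp add: star_add star_diff algebra_simps scaleR_2)
      ultimately show ?thesis by (simp add: scaleR_add_right)
    qed
    then have "gram x i j = (1 / 2) *\<^sub>R ((\<Sum>l<q. star (e l i) * z l j) + (\<Sum>l<q. star (z l i) * e l j)) + gram y i j"
      by (simp add: gram_eq_sum[OF xM] gram_eq_sum[OF yM] sum.distrib scaleR_sum_right scaleR_add_right)
    also have "(\<Sum>l<q. star (e l i) * z l j) = (\<Sum>l<q. if l = i then z l j else 0)"
      by (intro sum.cong) (auto simp: e_def)
    also have "\<dots> = z i j" using True by simp
    also have "(\<Sum>l<q. star (z l i) * e l j) = (\<Sum>l<q. if l = j then star (z l i) else 0)"
      by (intro sum.cong) (auto simp: e_def)
    also have "\<dots> = z i j" using True by (simp add: Herm_star[OF z])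
    finally show ?thesis by (simp add: scaleR_2[symmetric])
  next
    case False
    then show ?thesis
      using Herm_Mat[OF z] Herm_Mat[OF gram_in_Herm[OF xM]] Herm_Mat[OF gram_in_Herm[OF yM]]
      by (auto simp: Mat_def)
  qed
  then have "gram x = arr_add z (gram y)" by (auto simp: arr_add_def)
  moreover have "gram x \<in> gram_cone q" "gram y \<in> gram_cone q"
    using xM yM unfolding gram_cone_def by blast+
  ultimately show ?thesis using that by blast
qed

lemma arr_add_eq_simps:
  "arr_add x y = arr_add y x" "arr_add (arr_add x y) z = arr_add x (arr_add y z)"
  "arr_add x (arr_add y z) = arr_add y (arr_add x z)"
  "arr_add x y = arr_add x z \<longleftrightarrow> y = z"
  by (auto simp: arr_add_def algebra_simps fun_eq_iff)

text \<open>
  The cone spans the Hermitian matrices, so \<open>L r - L s\<close> is a well-defined linear functional of \<open>r - s\<close>.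
\<close>
lemma gram_cone_functional_representation:
  fixes L :: "'f::star_div_algebra arr \<Rightarrow> real"
  assumes add: "\<And>r s. r \<in> gram_cone q \<Longrightarrow> s \<in> gram_cone q \<Longrightarrow> L (arr_add r s) = L r + L s"
    and scale: "\<And>r t. r \<in> gram_cone q \<Longrightarrow> 0 \<le> t \<Longrightarrow> L (arr_scale t r) = t * L r"
  shows "\<exists>b\<in>Herm q. \<forall>r\<in>gram_cone q. L r = herm_inner q r b"
proof -
  have "\<exists>l. \<forall>r\<in>gram_cone q. \<forall>s\<in>gram_cone q. r = arr_add z s \<longrightarrow> l = L r - L s" if z: "z \<in> Herm q" for z
  proof -
    obtain r s where rs: "r \<in> gram_cone q" "s \<in> gram_cone q" "r = arr_add z s"
      by (rule Herm_eq_gram_cone_diff[OF z])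
    have "L r - L s = L r' - L s'" if "r' \<in> gram_cone q" "s' \<in> gram_cone q" "r' = arr_add z s'" for r' s'
    proof -
      have "arr_add r s' = arr_add r' s" using rs(3) that(3) by (simp add: arr_add_eq_simps)
      then have "L r + L s' = L r' + L s" using add rs that by metis
      then show ?thesis by simp
    qed
    then show ?thesis by blast
  qed
  then obtain l where l: "\<And>z r s. z \<in> Herm q \<Longrightarrow> r \<in> gram_cone q \<Longrightarrow> s \<in> gram_cone q \<Longrightarrow> r = arr_add z s \<Longrightarrow> l z = L r - L s"
    by metis
  have "\<exists>b\<in>Herm q. \<forall>r\<in>Herm q. l r = herm_inner q r b"
  proof (rule herm_functional_representation)
    fix z z' :: "'f arr" assume z: "z \<in> Herm q" "z' \<in> Herm q"
    obtain r s where rs: "r \<in> gram_cone q" "s \<in> gram_cone q" "r = arr_add z s"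
      by (rule Herm_eq_gram_cone_diff[OF z(1)])
    obtain r' s' where rs': "r' \<in> gram_cone q" "s' \<in> gram_cone q" "r' = arr_add z' s'"
      by (rule Herm_eq_gram_cone_diff[OF z(2)])
    have "arr_add r r' = arr_add (arr_add z z') (arr_add s s')"
      using rs(3) rs'(3) by (simp add: arr_add_eq_simps)
    then have "l (arr_add z z') = L (arr_add r r') - L (arr_add s s')"
      using rs rs' z by (intro l gram_cone_add Herm_add) auto
    then show "l (arr_add z z') = l z + l z'"
      using l[OF z(1) rs] l[OF z(2) rs'] rs rs' by (simp add: add)
  next
    fix z :: "'f arr" and t :: real assume z: "z \<in> Herm q"
    obtain r s where rs: "r \<in> gram_cone q" "s \<in> gram_cone q" "r = arr_add z s"
      by (rule Herm_eq_gram_cone_diff[OF z])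
    show "l (arr_scale t z) = t * l z"
    proof (cases "0 \<le> t")
      case True
      have "arr_scale t r = arr_add (arr_scale t z) (arr_scale t s)"
        unfolding rs(3) by (simp add: arr_scale_def arr_add_def algebra_simps)
      then have "l (arr_scale t z) = L (arr_scale t r) - L (arr_scale t s)"
        using rs z True by (intro l gram_cone_scale Herm_scale) auto
      then show ?thesis unfolding l[OF z rs] using rs(1,2) True by (simp add: scale right_diff_distrib)
    next
      case False
      have "arr_scale (- t) s = arr_add (arr_scale t z) (arr_scale (- t) r)"
        unfolding rs(3) by (simp add: arr_scale_def arr_add_def algebra_simps)
      then have "l (arr_scale t z) = L (arr_scale (- t) s) - L (arr_scale (- t) r)"
        using rs z False by (intro l gram_cone_scale Herm_scale) auto
      then show ?thesis unfolding l[OF z rs] using rs(1,2) False by (simp add: scale right_diff_distrib)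
    qed
  qed
  then obtain b where b: "b \<in> Herm q" "\<And>r. r \<in> Herm q \<Longrightarrow> l r = herm_inner q r b" by blast
  have zero: "arr_zero \<in> gram_cone q"
    unfolding gram_cone_def using zero_in_Mat[of q q] by (force simp: gram_def)
  have "L arr_zero = 0" using add[OF zero zero] by simp
  then have "L r = herm_inner q r b" if "r \<in> gram_cone q" for r
    using l[OF gram_cone_Herm[OF that] that zero] b(2)[OF gram_cone_Herm[OF that]] by simp
  with b(1) show ?thesis by blast
qed

section \<open>Spherical functions\<close>

lemma gram_Psd:
  assumes "a \<in> Psd q"
  shows "gram a = arr_mult a a"
  using assms by (simp add: gram_def Psd_def Herm_def)

lemma psi_eq:
  assumes "a \<in> Psd q"
  shows "psi q b a = exp (- (complex_of_real (herm_inner q (gram a) (fst b)) -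
    \<i> * complex_of_real (herm_inner q (gram a) (snd b))))"
proof -
  have "herm_inner q arr_zero c = 0" for c :: "'a arr"
    by (simp add: herm_inner_def) (simp add: arr_zero_def)
  then show ?thesis by (simp add: psi_def hermC_inner_def gram_Psd[OF assms])
qed

lemma herm_inner_add:
  assumes "r \<in> Herm q" "s \<in> Herm q"
  shows "herm_inner q (arr_add r s) b = herm_inner q r b + herm_inner q s b"
  using assms Herm_add[OF assms]
  by (simp add: herm_inner_eq_sum Herm_Mat arr_add_def distrib_right sum.distrib)

context biinvariant_function
begin

text \<open>
  By the polar decomposition the formula on \<open>\<Pi>\<^sub>q\<close> determines \<open>\<phi>\<close> everywhere as an exponential of a linear function
  of the Gram matrix, which is multiplicative on sums of Gram matrices.
\<close>
lemma psi_form_imp_olshanski: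
  assumes \<mu>: "\<And>p. q \<le> p \<Longrightarrow> normalized_haar p (\<mu> p)"
    and psi: "\<And>a. a \<in> Psd q \<Longrightarrow> \<phi> (g_elt a) = psi q b a"
  shows "olshanski_spherical q \<mu> \<phi>"
proof -
  define E where "E = (\<lambda>r :: 'f arr. exp (- (complex_of_real (herm_inner q r (fst b)) -
    \<i> * complex_of_real (herm_inner q r (snd b)))))"
  have \<phi>_E: "\<phi> (g_elt x) = E (gram x)" if x: "x \<in> Mat p q" for x p
  proof -
    obtain a where a: "a \<in> Psd q" "gram a = gram x" "\<phi> (g_elt x) = \<phi> (g_elt a)"
      by (rule phi_polar[OF x])
    then show ?thesis using psi[OF a(1)] psi_eq[OF a(1), of b] by (simp add: E_def)
  qed
  have E_add: "E (arr_add r s) = E r * E s" if "r \<in> Herm q" "s \<in> Herm q" for r s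
    by (simp add: E_def herm_inner_add[OF that] exp_add[symmetric] algebra_simps)
  have \<phi>_fst: "\<phi> (x, u) = \<phi> (g_elt x)" if "x \<in> Mat p q" "u \<in> Uni p" "q \<le> p" for x u p
    using phi_orbit[OF that(3,1,2) one_in_Uni] by simp
  have "(\<lambda>p. LINT k|\<mu> p. \<phi> (gmult (gmult g k) h)) \<longlonglongrightarrow> \<phi> g * \<phi> h"
    if gh: "g \<in> Ginf q" "h \<in> Ginf q" for g h
  proof -
    obtain x u y v m m' where g: "g = (x, u)" "x \<in> Mat m q" "u \<in> Uni m"
      and h: "h = (y, v)" "y \<in> Mat m' q" "v \<in> Uni m'"
      using gh by (auto simp: Ginf_def G_def)
    define n where "n = max q (max m m')"
    have n: "q \<le> n" "x \<in> Mat n q" "y \<in> Mat n q" "u \<in> Uni n" "v \<in> Uni n"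
      using g h by (auto simp: n_def intro: Mat_mono Uni_mono)
    note s = stack_in_Mat[OF n(2,3)]
    have "\<phi> (g_elt (stack n x y)) = \<phi> g * \<phi> h"
      using \<phi>_E[OF s] \<phi>_E[OF n(2)] \<phi>_E[OF n(3)] \<phi>_fst[OF n(2,4,1)] \<phi>_fst[OF n(3,5,1)]
      by (simp add: g(1) h(1) gram_stack[OF n(2,3)] E_add gram_in_Herm[OF n(2)] gram_in_Herm[OF n(3)])
    then show ?thesis
      using integral_phi_gmult_tendsto[OF \<mu> n s gram_stack[OF n(2,3)]] by (simp add: g(1) h(1))
  qed
  moreover have "\<exists>g\<in>Ginf q. \<phi> g \<noteq> 0"
  proof (rule bexI[of _ "g_elt arr_zero"])
    show "\<phi> (g_elt arr_zero) \<noteq> 0" using \<phi>_E[OF zero_in_Mat] by (simp add: E_def)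
    show "g_elt arr_zero \<in> Ginf q" by (auto simp: Ginf_def G_def g_elt_def zero_in_Mat one_in_Uni)
  qed
  ultimately show ?thesis
    unfolding olshanski_spherical_def using continuous biinvariant by blast
qed

text \<open>
  The limit required of a spherical function and the limit computed by \<open>integral_phi_gmult_tendsto\<close> agree.
\<close>
lemma olshanski_imp_multiplicative:
  assumes \<mu>: "\<And>p. q \<le> p \<Longrightarrow> normalized_haar p (\<mu> p)"
    and olsh: "olshanski_spherical q \<mu> \<phi>"
    and xyz: "x \<in> Mat n q" "y \<in> Mat m q" "z \<in> Mat N q" and gram_z: "gram z = arr_add (gram x) (gram y)"
  shows "\<phi> (g_elt z) = \<phi> (g_elt x) * \<phi> (g_elt y)"
proof -
  define P where "P = max q (max n m)"
  have P: "q \<le> P" "x \<in> Mat P q" "y \<in> Mat P q"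
    using xyz by (auto simp: P_def intro: Mat_mono)
  then have "g_elt x \<in> Ginf q" "g_elt y \<in> Ginf q"
    by (auto simp: Ginf_def G_def g_elt_def one_in_Uni)
  then have "(\<lambda>p. LINT k|\<mu> p. \<phi> (gmult (gmult (x, arr_one) k) (y, arr_one))) \<longlonglongrightarrow>
      \<phi> (g_elt x) * \<phi> (g_elt y)"
    using olsh unfolding olshanski_spherical_def g_elt_def by blast
  moreover have "(\<lambda>p. LINT k|\<mu> p. \<phi> (gmult (gmult (x, arr_one) k) (y, arr_one))) \<longlonglongrightarrow> \<phi> (g_elt z)"
    by (rule integral_phi_gmult_tendsto[OF \<mu> P one_in_Uni one_in_Uni xyz(3) gram_z])
  ultimately show ?thesis using LIMSEQ_unique by blast
qed

text \<open>
  Scaling \<open>x\<close> by \<open>sqrt t\<close> scales its Gram matrix by \<open>t\<close>, so \<open>t \<mapsto> \<Phi> (sqrt t x)\<close> is continuous and multiplicative.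
\<close>
lemma multiplicative_imp_exp_on_ray:
  assumes mult: "\<And>x y z n m N. x \<in> Mat n q \<Longrightarrow> y \<in> Mat m q \<Longrightarrow> z \<in> Mat N q \<Longrightarrow>
      gram z = arr_add (gram x) (gram y) \<Longrightarrow> \<phi> (g_elt z) = \<phi> (g_elt x) * \<phi> (g_elt y)"
    and zero: "\<phi> (g_elt arr_zero) = 1"
    and r: "r \<in> gram_cone q"
  shows "\<exists>c. \<forall>t\<ge>0. \<forall>p. \<forall>x\<in>Mat p q. gram x = arr_scale t r \<longrightarrow> \<phi> (g_elt x) = exp (t *\<^sub>R c)"
proof -
  obtain x0 n where x0': "x0 \<in> Mat n q" "r = gram x0" using r by (auto simp: gram_cone_def)
  define p where "p = max q n"
  have x0: "x0 \<in> Mat p q" "q \<le> p" using x0'(1) by (auto simp: p_def intro: Mat_mono)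
  define f where "f = (\<lambda>t. \<phi> (g_elt (arr_scale (sqrt t) x0)))"
  have gram: "gram (arr_scale (sqrt t) x0) = arr_scale t r" if "0 \<le> t" for t
    using that by (simp add: gram_scale[OF x0(1)] x0'(2))
  have "\<exists>c. \<forall>t\<ge>0. f t = exp (t *\<^sub>R c)"
  proof (rule continuous_multiplicative_imp_exp)
    have "continuous_on {0..} (\<lambda>t. sqrt t *\<^sub>R x0 i j)" for i j
      by (intro continuous_on_scaleR continuous_on_real_sqrt continuous_on_id continuous_on_const)
    then have "continuous_on {0..} (\<lambda>t. arr_scale (sqrt t) x0)"
      unfolding arr_scale_def by (rule continuous_on_arrI)
    then show "continuous_on {0..} f"
      unfolding f_def
      by (rule continuous_on_compose2[OF continuous_on_phi_g_elt[OF x0(2)]]) (auto intro: Mat_scale x0)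
    show "f 0 = 1" using zero by (simp add: f_def arr_scale_def arr_zero_def)
    fix s t :: real assume "0 \<le> s" "0 \<le> t"
    moreover have "arr_scale (s + t) r = arr_add (arr_scale s r) (arr_scale t r)"
      by (simp add: arr_scale_def arr_add_def scaleR_add_left)
    ultimately show "f (s + t) = f s * f t"
      unfolding f_def
      by (intro mult[OF Mat_scale[OF x0(1)] Mat_scale[OF x0(1)] Mat_scale[OF x0(1)]]) (simp add: gram)
  qed
  then obtain c where c: "\<And>t. 0 \<le> t \<Longrightarrow> f t = exp (t *\<^sub>R c)" by blast
  show ?thesis
  proof (intro exI[of _ c] allI impI ballI)
    fix t :: real and p' and x :: "'f arr"
    assume "0 \<le> t" "x \<in> Mat p' q" "gram x = arr_scale t r"
    then show "\<phi> (g_elt x) = exp (t *\<^sub>R c)"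
      using phi_eq_if_gram_eq[of x p' "arr_scale (sqrt t) x0" p] c[of t] gram[of t] Mat_scale[OF x0(1)]
      by (simp add: f_def)
  qed
qed

text \<open>
  The exponents \<open>L r\<close> on the rays are determined uniquely by \<open>\<phi>\<close>, so multiplicativity of \<open>\<phi>\<close> makes \<open>L\<close>
  additive and homogeneous. Its real and imaginary parts yield the two components of \<open>b\<close>; the signs come
  from \<open>- \<langle>r, b\<rangle> = - \<langle>r, b\<^sub>1\<rangle> + \<i> \<langle>r, b\<^sub>2\<rangle>\<close>, as the scalar product is conjugate-linear in \<open>b\<close>.
\<close>
lemma multiplicative_imp_psi_form:
  assumes mult: "\<And>x y z n m N. x \<in> Mat n q \<Longrightarrow> y \<in> Mat m q \<Longrightarrow> z \<in> Mat N q \<Longrightarrow>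
      gram z = arr_add (gram x) (gram y) \<Longrightarrow> \<phi> (g_elt z) = \<phi> (g_elt x) * \<phi> (g_elt y)"
    and nz: "x1 \<in> Mat n1 q" "\<phi> (g_elt x1) \<noteq> 0"
  shows "\<exists>b\<in>HermC q. \<forall>a\<in>Psd q. \<phi> (g_elt a) = psi q b a"
proof -
  have gram_zero: "gram arr_zero = (arr_zero :: 'f arr)" by (simp add: gram_def)
  have "\<phi> (g_elt x1) = \<phi> (g_elt x1) * \<phi> (g_elt arr_zero)"
    by (rule mult[OF nz(1) zero_in_Mat nz(1)]) (simp add: gram_zero)
  then have zero: "\<phi> (g_elt arr_zero) = 1" using nz(2) by simp
  have "\<exists>c. \<forall>t\<ge>0. \<forall>p. \<forall>x\<in>Mat p q. gram x = arr_scale t r \<longrightarrow> \<phi> (g_elt x) = exp (t *\<^sub>R c)"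
    if "r \<in> gram_cone q" for r
    using zero that by (intro multiplicative_imp_exp_on_ray) (rule mult)
  then obtain L where L: "\<And>r t p x. r \<in> gram_cone q \<Longrightarrow> 0 \<le> t \<Longrightarrow> x \<in> Mat p q \<Longrightarrow>
      gram x = arr_scale t r \<Longrightarrow> \<phi> (g_elt x) = exp (t *\<^sub>R L r)"
    by metis
  have cone_rep: "\<exists>x p. x \<in> Mat p q \<and> gram x = r" if "r \<in> gram_cone q" for r :: "'f arr"
    using that by (auto simp: gram_cone_def)
  have L_add: "L (arr_add r s) = L r + L s" if r: "r \<in> gram_cone q" and s: "s \<in> gram_cone q" for r s
  proof (rule exp_scaleR_inj)
    fix t :: real assume t: "0 \<le> t"
    obtain x n y m where x: "x \<in> Mat n q" "gram x = arr_scale t r" and y: "y \<in> Mat m q" "gram y = arr_scale t s"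
      using cone_rep[OF gram_cone_scale[OF r t]] cone_rep[OF gram_cone_scale[OF s t]] by blast
    have "gram (stack n x y) = arr_scale t (arr_add r s)"
      by (simp add: gram_stack[OF x(1) y(1)] x(2) y(2)) (simp add: arr_scale_def arr_add_def scaleR_add_right)
    then have "exp (t *\<^sub>R L (arr_add r s)) = \<phi> (g_elt (stack n x y))"
      using L[OF gram_cone_add[OF r s] t stack_in_Mat[OF x(1) y(1)]] by simp
    also have "\<dots> = \<phi> (g_elt x) * \<phi> (g_elt y)"
      by (rule mult[OF x(1) y(1) stack_in_Mat[OF x(1) y(1)] gram_stack[OF x(1) y(1)]])
    finally show "exp (t *\<^sub>R L (arr_add r s)) = exp (t *\<^sub>R (L r + L s))"
      using L[OF r t x] L[OF s t y] by (simp add: scaleR_add_right exp_add)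
  qed
  have L_scale: "L (arr_scale u r) = u *\<^sub>R L r" if r: "r \<in> gram_cone q" and u: "0 \<le> u" for r u
  proof (rule exp_scaleR_inj)
    fix t :: real assume t: "0 \<le> t"
    obtain x n where x: "x \<in> Mat n q" "gram x = arr_scale t (arr_scale u r)"
      using cone_rep[OF gram_cone_scale[OF gram_cone_scale[OF r u] t]] by blast
    have "gram x = arr_scale (t * u) r" using x(2) by (simp add: arr_scale_def)
    then show "exp (t *\<^sub>R L (arr_scale u r)) = exp (t *\<^sub>R (u *\<^sub>R L r))"
      using L[OF gram_cone_scale[OF r u] t x] L[OF r _ x(1), of "t * u"] t u by simp
  qed
  obtain b1 where b1: "b1 \<in> Herm q" "\<And>r. r \<in> gram_cone q \<Longrightarrow> - Re (L r) = herm_inner q r b1"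
    using gram_cone_functional_representation[of q "\<lambda>r. - Re (L r)"] L_add L_scale by auto
  obtain b2 where b2: "b2 \<in> Herm q" "\<And>r. r \<in> gram_cone q \<Longrightarrow> Im (L r) = herm_inner q r b2"
    using gram_cone_functional_representation[of q "\<lambda>r. Im (L r)"] L_add L_scale by auto
  have "\<phi> (g_elt a) = psi q (b1, b2) a" if a: "a \<in> Psd q" for a
  proof -
    have ga: "gram a \<in> gram_cone q" using Psd_Mat[OF a] by (auto simp: gram_cone_def)
    have "\<phi> (g_elt a) = exp (L (gram a))"
      using L[OF ga _ Psd_Mat[OF a], of 1] by (simp add: arr_scale_def)
    also have "L (gram a) = - (complex_of_real (herm_inner q (gram a) b1) - \<i> * complex_of_real (herm_inner q (gram a) b2))"
      by (simp add: b1(2)[OF ga, symmetric] b2(2)[OF ga, symmetric] complex_eq_iff)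
    finally show ?thesis by (simp add: psi_eq[OF a])
  qed
  then show ?thesis using b1(1) b2(1) by (intro bexI[of _ "(b1, b2)"]) (auto simp: HermC_def)
qed

theorem olshanski_iff_psi_form:
  assumes \<mu>: "\<And>p. q \<le> p \<Longrightarrow> normalized_haar p (\<mu> p)"
  shows "olshanski_spherical q \<mu> \<phi> \<longleftrightarrow> (\<exists>b\<in>HermC q. \<forall>a\<in>Psd q. \<phi> (g_elt a) = psi q b a)"
proof
  assume olsh: "olshanski_spherical q \<mu> \<phi>"
  then obtain g where "g \<in> Ginf q" "\<phi> g \<noteq> 0" by (auto simp: olshanski_spherical_def)
  then obtain x u p where "q \<le> p" "x \<in> Mat p q" "u \<in> Uni p" "\<phi> (x, u) \<noteq> 0"
    by (auto simp: Ginf_def G_def)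
  then have "x \<in> Mat p q" "\<phi> (g_elt x) \<noteq> 0"
    using phi_orbit[OF _ _ _ one_in_Uni] by auto
  then show "\<exists>b\<in>HermC q. \<forall>a\<in>Psd q. \<phi> (g_elt a) = psi q b a"
    using olshanski_imp_multiplicative[OF \<mu> olsh] by (intro multiplicative_imp_psi_form) blast+
next
  assume "\<exists>b\<in>HermC q. \<forall>a\<in>Psd q. \<phi> (g_elt a) = psi q b a"
  then show "olshanski_spherical q \<mu> \<phi>"
    using psi_form_imp_olshanski[OF \<mu>] by blast
qed

end

theorem theorem4p5:
  assumes "1 \<le> (q::nat)"
  shows
   "(\<forall>(\<mu> :: nat \<Rightarrow> real elt measure) \<phi>.
       (\<forall>p\<ge>q. normalized_haar p (\<mu> p)) \<longrightarrow>
       continuous_map (Ginf_topology q) euclidean \<phi> \<longrightarrow> K_biinvariant q \<phi> \<longrightarrow>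
       (olshanski_spherical q \<mu> \<phi> \<longleftrightarrow>
         (\<exists>b\<in>HermC q. \<forall>a\<in>Psd q. \<phi> (g_elt a) = psi q b a))) \<and>
    (\<forall>(\<mu> :: nat \<Rightarrow> complex elt measure) \<phi>.
       (\<forall>p\<ge>q. normalized_haar p (\<mu> p)) \<longrightarrow>
       continuous_map (Ginf_topology q) euclidean \<phi> \<longrightarrow> K_biinvariant q \<phi> \<longrightarrow>
       (olshanski_spherical q \<mu> \<phi> \<longleftrightarrow>
         (\<exists>b\<in>HermC q. \<forall>a\<in>Psd q. \<phi> (g_elt a) = psi q b a))) \<and>
    (\<forall>(\<mu> :: nat \<Rightarrow> quat elt measure) \<phi>.
       (\<forall>p\<ge>q. normalized_haar p (\<mu> p)) \<longrightarrow>
       continuous_map (Ginf_topology q) euclidean \<phi> \<longrightarrow> K_biinvariant q \<phi> \<longrightarrow>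
       (olshanski_spherical q \<mu> \<phi> \<longleftrightarrow>
         (\<exists>b\<in>HermC q. \<forall>a\<in>Psd q. \<phi> (g_elt a) = psi q b a)))"
  by (intro conjI allI impI)
     (simp_all add: biinvariant_function.olshanski_iff_psi_form[OF biinvariant_function.intro])

end
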